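(* Let $n,k\ge1$ be integers. For each $i\in\{0,1,\dots,k\}$ let $\mathcal V_i:=\operatorname{co}\{v_i^1,\dots,v_i^{s_i}\}\subset\mathbb{R}^{n_i}$ ($s_i\ge1$), and let $r:=s_0$. Suppose that, for each $i\in\{0,1,\dots,k\}$, $x\mapsto f_i(x,v_i)$ is an SOS-convex polynomial on $\mathbb{R}^n$ for each $v_i\in\mathcal V_i$, and $v_i\mapsto f_i(x,v_i)$ is affine for each $x\in\mathbb{R}^n$. Assume that there exists $\bar x\in\mathbb{R}^n$ such that $f_i(\bar x,v_i^j)<0$ for all $j=1,\dots,s_i$ and $i=1,\dots,k$. Consider $$(RP)\quad \inf_{x\in\mathbb{R}^n}\Big\{\sup_{v_0\in\mathcal V_0}f_0(x,v_0) : f_i(x,v_i)\le 0\ \ \forall v_i\in\mathcal V_i,\ \forall i=1,\dots,k\Big\}$$ and $$(RD)\quad \sup\Big\{\mu : \sum_{l=1}^r\delta_lf_0(\cdot,v_0^l)+\sum_{i=1}^k\sum_{j=1}^{s_i}\lambda_i^jf_i(\cdot,v_i^j)-\mu\in\Sigma^2_t,\ \delta\in\Delta,\ \lambda_i\in\mathbb{R}^{s_i}_+\ (i=1,\dots,k),\ \mu\in\mathbb{R}\Big\},$$ where $t$ is the smallest even number such that $t\ge\max\{\max_{1\le l\le r}\deg f_0(\cdot,v_0^l),\ \max_{1\le i\le k}\max_{1\le j\le s_i}\deg f_i(\cdot,v_i^j)\}$. Then $$\inf(RP)=\max(RD).$$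
   Context: $\operatorname{co}$ denotes the convex hull. $\mathbb{R}^q_+$ denotes the set of vectors in $\mathbb{R}^q$ with nonnegative coordinates, and $\Delta:=\{\delta\in\mathbb{R}^r_+ : \sum_{l=1}^r\delta_l=1\}$. A real polynomial $f$ on $\mathbb{R}^n$ is a sum of squares if it is a finite sum of squares of real polynomials; $\Sigma^2_t$ is the set of sum of squares real polynomials on $\mathbb{R}^n$ of degree at most $t$. A real polynomial $f$ on $\mathbb{R}^n$ is SOS-convex if its Hessian is an SOS-matrix polynomial, i.e. $\nabla^2 f(x)=H(x)H(x)^T$ for some $s\in\mathbb{N}$ and some matrix polynomial $H\in\mathbb{R}[x]^{n\times s}$. $\inf(RP)$ denotes the optimal value of $(RP)$; writing $\max(RD)$ for the optimal value of $(RD)$ means that the supremum in $(RD)$ is attained.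
   Formalization: Attainment of the supremum in (RD) is asserted only when inf(RP) is not −∞; if inf(RP) = −∞ (e.g. f_0 = x, f_1 = −1), (RD) has no feasible point and only the equality of the optimal values, both −∞, is claimed. *)

theory Defs
  imports "HOL-Analysis.Analysis" "HOL-Library.Function_Algebras"
begin

(* Pointwise real vector space structure on functions. The spaces R^m, whose dimension m varies with
   an index, are the subspaces topspace (Euclidean_space m) = {x. \<forall>i\<ge>m. x i = 0} of nat \<Rightarrow> real;
   this instance makes "convex hull" available for them. *)

instantiation "fun" :: (type, real_vector) real_vector
begin

definition scaleR_fun :: "real \<Rightarrow> ('a \<Rightarrow> 'b) \<Rightarrow> 'a \<Rightarrow> 'b"
  where "scaleR_fun c f = (\<lambda>x. c *\<^sub>R f x)"

instance
  by standard (auto simp: scaleR_fun_def fun_eq_iff algebra_simps)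

end

definition affine_map_on :: "'a::real_vector set \<Rightarrow> ('a \<Rightarrow> real) \<Rightarrow> bool"
  where "affine_map_on S g \<longleftrightarrow>
    (\<forall>x\<in>S. \<forall>y\<in>S. \<forall>a b. a + b = 1 \<longrightarrow> g (a *\<^sub>R x + b *\<^sub>R y) = a * g x + b * g y)"

(* Real polynomials on R^n are identified with the functions they induce (real_polynomial_function),
   which loses nothing since the real field is infinite. *)

(* Total degree: the least d such that p is a linear combination of monomials of total degree at
   most d. The zero polynomial gets degree 0. *)
definition total_degree :: "(real ^ 'n \<Rightarrow> real) \<Rightarrow> nat"
  where "total_degree p =
    (LEAST d. \<exists>c :: ('n \<Rightarrow> nat) \<Rightarrow> real. \<forall>x.
       p x = (\<Sum>\<alpha> | (\<Sum>i\<in>UNIV. \<alpha> i) \<le> d. c \<alpha> * (\<Prod>i\<in>UNIV. (x $ i) ^ \<alpha> i)))"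

definition sum_of_squares :: "(real ^ 'n \<Rightarrow> real) \<Rightarrow> bool"
  where "sum_of_squares p \<longleftrightarrow>
    (\<exists>(N::nat) q. (\<forall>j<N. real_polynomial_function (q j)) \<and> (\<forall>x. p x = (\<Sum>j<N. (q j x)\<^sup>2)))"

definition Sigma2 :: "nat \<Rightarrow> (real ^ 'n \<Rightarrow> real) set"
  where "Sigma2 t = {p. sum_of_squares p \<and> total_degree p \<le> t}"

definition gradient :: "(real ^ 'n \<Rightarrow> real) \<Rightarrow> real ^ 'n \<Rightarrow> real ^ 'n"
  where "gradient p x = (\<chi> i. frechet_derivative p (at x) (axis i 1))"

definition hessian :: "(real ^ 'n \<Rightarrow> real) \<Rightarrow> real ^ 'n \<Rightarrow> real ^ 'n ^ 'n"
  where "hessian p x = jacobian (gradient p) (at x)"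

(* The n x s matrix polynomial H is given by its entries H a j (a indexing R^n, j < s); since s is
   not a type, the product H(x) H(x)^T is written out entrywise. *)
definition sos_convex :: "(real ^ 'n \<Rightarrow> real) \<Rightarrow> bool"
  where "sos_convex p \<longleftrightarrow> real_polynomial_function p \<and>
    (\<exists>(s::nat) (H :: 'n \<Rightarrow> nat \<Rightarrow> real ^ 'n \<Rightarrow> real).
       (\<forall>a. \<forall>j<s. real_polynomial_function (H a j)) \<and>
       (\<forall>x a b. hessian p x $ a $ b = (\<Sum>j<s. H a j x * H b j x)))"

definition robust_feasible ::
    "nat \<Rightarrow> (nat \<Rightarrow> real ^ 'n \<Rightarrow> (nat \<Rightarrow> real) \<Rightarrow> real) \<Rightarrow> (nat \<Rightarrow> (nat \<Rightarrow> real) set) \<Rightarrow> (real ^ 'n) set"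
  where "robust_feasible k f V = {x. \<forall>i\<in>{1..k}. \<forall>w\<in>V i. f i x w \<le> 0}"

definition inf_RP ::
    "nat \<Rightarrow> (nat \<Rightarrow> real ^ 'n \<Rightarrow> (nat \<Rightarrow> real) \<Rightarrow> real) \<Rightarrow> (nat \<Rightarrow> (nat \<Rightarrow> real) set) \<Rightarrow> ereal"
  where "inf_RP k f V = (INF x\<in>robust_feasible k f V. SUP w\<in>V 0. ereal (f 0 x w))"

definition RD_degree ::
    "nat \<Rightarrow> (nat \<Rightarrow> real ^ 'n \<Rightarrow> (nat \<Rightarrow> real) \<Rightarrow> real) \<Rightarrow> (nat \<Rightarrow> nat) \<Rightarrow> (nat \<Rightarrow> nat \<Rightarrow> nat \<Rightarrow> real) \<Rightarrow> nat"
  where "RD_degree k f s v =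
    (LEAST t. even t \<and>
       max (Max {total_degree (\<lambda>x. f 0 x (v 0 l)) | l. l \<in> {1..s 0}})
           (Max {Max {total_degree (\<lambda>x. f i x (v i j)) | j. j \<in> {1..s i}} | i. i \<in> {1..k}}) \<le> t)"

(* The values \<mu> for which (RD) has a feasible point (\<delta>, lam, \<mu>); only the entries \<delta> l (1 \<le> l \<le> s 0)
   and lam i j (1 \<le> i \<le> k, 1 \<le> j \<le> s i) matter. *)
definition RD_values ::
    "nat \<Rightarrow> (nat \<Rightarrow> real ^ 'n \<Rightarrow> (nat \<Rightarrow> real) \<Rightarrow> real) \<Rightarrow> (nat \<Rightarrow> nat) \<Rightarrow> (nat \<Rightarrow> nat \<Rightarrow> nat \<Rightarrow> real) \<Rightarrow> real set"
  where "RD_values k f s v = {\<mu>. \<exists>\<delta> lam.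
    (\<forall>l\<in>{1..s 0}. 0 \<le> \<delta> l) \<and> (\<Sum>l=1..s 0. \<delta> l) = 1 \<and>
    (\<forall>i\<in>{1..k}. \<forall>j\<in>{1..s i}. 0 \<le> lam i j) \<and>
    (\<lambda>x. (\<Sum>l=1..s 0. \<delta> l * f 0 x (v 0 l)) + (\<Sum>i=1..k. \<Sum>j=1..s i. lam i j * f i x (v i j)) - \<mu>)
      \<in> Sigma2 (RD_degree k f s v)}"

definition sup_RD ::
    "nat \<Rightarrow> (nat \<Rightarrow> real ^ 'n \<Rightarrow> (nat \<Rightarrow> real) \<Rightarrow> real) \<Rightarrow> (nat \<Rightarrow> nat) \<Rightarrow> (nat \<Rightarrow> nat \<Rightarrow> nat \<Rightarrow> real) \<Rightarrow> ereal"
  where "sup_RD k f s v = (SUP \<mu>\<in>RD_values k f s v. ereal \<mu>)"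

end

theory Submission
  imports Defs
begin

text \<open>Let \<open>\<mu>\<close> be the finite value of (RP). No point makes all \<open>f\<^sub>0(x, v\<^sub>0\<^sup>l) - \<mu>\<close> and all
  \<open>f\<^sub>i(x, v\<^sub>i\<^sup>j)\<close> negative, so some convex combination of these convex functions is nonnegative
  (Gordan's alternative). Slater's condition forces positive weight on the objective, and after
  scaling we obtain a nonnegative polynomial of the form required in (RD). It is SOS-convex, being a
  nonnegative combination of SOS-convex polynomials. A convex polynomial bounded below attains its
  minimum, and at a minimizer Taylor's formula with integral remainder turns the factorization of
  the Hessian into a representation of the polynomial as a sum of squares.\<close>

section \<open>Alternatives for convex functions\<close>

text \<open>Attainment in (RD) needs no closedness argument for a cone of sums of squares: the
  multipliers come from a separation at the exact value \<mu>, and the polynomial they produce is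
  nonnegative for that same \<mu>. The obstacle is that nonnegativity does not give a sum of squares
  in general. SOS-convexity controls second derivatives only, so value and gradient have to vanish
  at the base point; a global minimizer provides this. A convex function bounded below may lack one,
  like exp; polynomials are rescued because boundedness on a ray forces them to be constant along
  its line. The integral in Taylor's formula must also become a finite sum: for the weight 1 - t on
  [0,1], the moments of the powers t^(k+l) form a positive semidefinite matrix, and its Gram factor
  supplies the coefficients of the squares. Uncertainty enters only through affinity in v, which
  reduces each supremum to finitely many vertices. If the value of (RP) is -\<infinity>, weak
  duality leaves (RD) without feasible points, so attainment is asserted only for the other
  values.\<close>

lemma gordan_convex_two:
  fixes g h :: "'a::real_vector \<Rightarrow> real"
  assumes g: "convex_on S g" and h: "convex_on S h"
    and alt: "\<And>x. x \<in> S \<Longrightarrow> 0 \<le> g x \<or> 0 \<le> h x"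
  shows "\<exists>c\<in>{0..1}. \<forall>x\<in>S. 0 \<le> c * g x + (1 - c) * h x"
proof (cases "S = {}")
  case True
  then show ?thesis by (intro bexI[of _ 0]) auto
next
  case False
  then obtain x0 where x0: "x0 \<in> S" by auto
  define N where "N = {..<0::real} \<times> {..<0::real}"
  \<comment> \<open>The image of \<open>(g, h)\<close> need not be convex; adding all larger pairs
    makes it so and keeps it disjoint from the open negative quadrant.\<close>
  define T where "T = {(y, z). \<exists>x\<in>S. g x \<le> y \<and> h x \<le> z}"
  have "convex N"
    unfolding N_def by (intro convex_Times) auto
  moreover have "convex T"
  proof (rule convexI)
    fix p q :: "real \<times> real" and a b :: real
    assume p: "p \<in> T" and q: "q \<in> T" and ab: "0 \<le> a" "0 \<le> b" "a + b = 1"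
    obtain y1 z1 x1 where 1: "p = (y1, z1)" "x1 \<in> S" "g x1 \<le> y1" "h x1 \<le> z1"
      using p by (auto simp: T_def)
    obtain y2 z2 x2 where 2: "q = (y2, z2)" "x2 \<in> S" "g x2 \<le> y2" "h x2 \<le> z2"
      using q by (auto simp: T_def)
    have "g (a *\<^sub>R x1 + b *\<^sub>R x2) \<le> a * g x1 + b * g x2" "h (a *\<^sub>R x1 + b *\<^sub>R x2) \<le> a * h x1 + b * h x2"
      using g h 1 2 ab by (auto simp: convex_on_def)
    moreover have "a * g x1 + b * g x2 \<le> a * y1 + b * y2" "a * h x1 + b * h x2 \<le> a * z1 + b * z2"
      using 1 2 ab by (auto intro!: add_mono mult_left_mono)
    moreover have "a *\<^sub>R x1 + b *\<^sub>R x2 \<in> S"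
      using g 1 2 ab by (auto simp: convex_on_def convex_def)
    ultimately show "a *\<^sub>R p + b *\<^sub>R q \<in> T"
      unfolding T_def 1 2 by (fastforce intro!: bexI[of _ "a *\<^sub>R x1 + b *\<^sub>R x2"])
  qed
  moreover have "N \<noteq> {}"
    unfolding N_def by (auto simp: ex_in_conv[symmetric] intro!: exI[of _ "-1::real"])
  moreover have "T \<noteq> {}"
    using x0 by (auto simp: T_def)
  moreover have "N \<inter> T = {}"
    using alt by (fastforce simp: N_def T_def)
  ultimately obtain a b where ab: "a \<noteq> 0" "\<forall>x\<in>N. a \<bullet> x \<le> b" "\<forall>x\<in>T. b \<le> a \<bullet> x"
    using separating_hyperplane_sets by metis
  obtain \<alpha> \<beta> where a: "a = (\<alpha>, \<beta>)" by fastforce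
  have N: "\<alpha> * y + \<beta> * z \<le> b" if "y < 0" "z < 0" for y z
    using ab(2) that by (force simp: N_def a)
  have T: "b \<le> \<alpha> * y + \<beta> * z" if "x \<in> S" "g x \<le> y" "h x \<le> z" for x y z
    using ab(3) that by (force simp: T_def a)
  \<comment> \<open>The origin is a limit of points \<open>(-e, -e)\<close> of \<open>N\<close>, so
    the separating level \<open>b\<close> is nonnegative.\<close>
  have "((\<lambda>e::real. \<alpha> * (- e) + \<beta> * (- e)) \<longlongrightarrow> \<alpha> * (- 0) + \<beta> * (- 0)) (at_right 0)"
    by (intro tendsto_intros)
  moreover have "\<forall>\<^sub>F e::real in at_right 0. \<alpha> * (- e) + \<beta> * (- e) \<le> b"
    using eventually_at_right_less by (rule eventually_mono) (auto intro: N[of "- _" "- _", simplified])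
  ultimately have b: "0 \<le> b"
    using tendsto_upperbound[of _ _ "at_right (0::real)" b] by fastforce
  have nonneg: "0 \<le> \<alpha>" "0 \<le> \<beta>"
  proof -
    show "0 \<le> \<alpha>"
    proof (rule ccontr)
      assume "\<not> 0 \<le> \<alpha>"
      \<comment> \<open>The first entry of the maximum keeps \<open>(y, h x0)\<close> in
        \<open>T\<close>; the second makes the functional at most \<open>b - 1\<close>
        there.\<close>
      define y where "y = max (g x0) ((b - \<beta> * h x0 - 1) / \<alpha>)"
      have "\<alpha> * y \<le> \<alpha> * ((b - \<beta> * h x0 - 1) / \<alpha>)"
        using \<open>\<not> 0 \<le> \<alpha>\<close> unfolding y_def by (intro mult_left_mono_neg) auto
      then have "\<alpha> * y \<le> b - \<beta> * h x0 - 1"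
        using \<open>\<not> 0 \<le> \<alpha>\<close> by simp
      with T[OF x0, of y "h x0"] show False by (auto simp: y_def)
    qed
    show "0 \<le> \<beta>"
    proof (rule ccontr)
      assume "\<not> 0 \<le> \<beta>"
      define z where "z = max (h x0) ((b - \<alpha> * g x0 - 1) / \<beta>)"
      have "\<beta> * z \<le> \<beta> * ((b - \<alpha> * g x0 - 1) / \<beta>)"
        using \<open>\<not> 0 \<le> \<beta>\<close> unfolding z_def by (intro mult_left_mono_neg) auto
      then have "\<beta> * z \<le> b - \<alpha> * g x0 - 1"
        using \<open>\<not> 0 \<le> \<beta>\<close> by simp
      with T[OF x0, of "g x0" z] show False by (auto simp: z_def)
    qed
  qed
  have pos: "0 < \<alpha> + \<beta>"
    using nonneg ab(1) by (auto simp: a zero_prod_def add_nonneg_eq_0_iff less_le)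
  show ?thesis
  proof (intro bexI[of _ "\<alpha> / (\<alpha> + \<beta>)"] ballI)
    fix x assume "x \<in> S"
    have "1 - \<alpha> / (\<alpha> + \<beta>) = \<beta> / (\<alpha> + \<beta>)"
      using pos by (simp add: field_simps)
    then have "\<alpha> / (\<alpha> + \<beta>) * g x + (1 - \<alpha> / (\<alpha> + \<beta>)) * h x = (\<alpha> * g x + \<beta> * h x) / (\<alpha> + \<beta>)"
      by (simp add: add_divide_distrib)
    also have "\<dots> \<ge> 0"
      using T[OF \<open>x \<in> S\<close>, of "g x" "h x"] b pos by simp
    finally show "0 \<le> \<alpha> / (\<alpha> + \<beta>) * g x + (1 - \<alpha> / (\<alpha> + \<beta>)) * h x" .
  qed (use nonneg pos in auto)
qed

lemma convex_on_Max:
  fixes g :: "'i \<Rightarrow> 'a::real_vector \<Rightarrow> real"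
  assumes "finite I" "I \<noteq> {}" "\<And>i. i \<in> I \<Longrightarrow> convex_on S (g i)"
  shows "convex_on S (\<lambda>x. Max ((\<lambda>i. g i x) ` I))"
proof -
  have "convex S"
    using assms by (auto simp: convex_on_def)
  moreover have "Max ((\<lambda>i. g i (u *\<^sub>R x + v *\<^sub>R y)) ` I)
      \<le> u * Max ((\<lambda>i. g i x) ` I) + v * Max ((\<lambda>i. g i y) ` I)"
    if "x \<in> S" "y \<in> S" "0 \<le> u" "0 \<le> v" "u + v = 1" for x y u v
  proof (rule Max.boundedI)
    fix r assume "r \<in> (\<lambda>i. g i (u *\<^sub>R x + v *\<^sub>R y)) ` I"
    then obtain i where i: "i \<in> I" "r = g i (u *\<^sub>R x + v *\<^sub>R y)" by auto
    then have "r \<le> u * g i x + v * g i y"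
      using assms(3)[of i] that by (auto simp: convex_on_def)
    also have "\<dots> \<le> u * Max ((\<lambda>i. g i x) ` I) + v * Max ((\<lambda>i. g i y) ` I)"
      using i assms(1) that by (intro add_mono mult_left_mono Max_ge) auto
    finally show "r \<le> \<dots>" .
  qed (use assms in auto)
  ultimately show ?thesis
    by (auto simp: convex_on_def)
qed

text \<open>Induction keeps the separation in the plane. The family over \<open>I\<close> is
  collapsed to its maximum and paired with the new function \<open>g j\<close>; the resulting
  \<open>c\<close> is mixed into every member. The mixtures again satisfy the hypothesis, because at
  each point some index realizes the maximum.\<close>

lemma gordan_convex:
  fixes g :: "'i \<Rightarrow> 'a::real_vector \<Rightarrow> real"
  assumes "finite I" "I \<noteq> {}" "\<And>i. i \<in> I \<Longrightarrow> convex_on S (g i)"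
    and "\<And>x. x \<in> S \<Longrightarrow> \<exists>i\<in>I. 0 \<le> g i x"
  shows "\<exists>w. (\<forall>i\<in>I. 0 \<le> w i) \<and> sum w I = 1 \<and> (\<forall>x\<in>S. 0 \<le> (\<Sum>i\<in>I. w i * g i x))"
  using assms
proof (induction I arbitrary: g rule: finite_ne_induct)
  case (singleton i)
  then show ?case by (intro exI[of _ "\<lambda>_. 1"]) auto
next
  case (insert j I)
  define h where "h = (\<lambda>x. Max ((\<lambda>i. g i x) ` I))"
  have "convex_on S h"
    unfolding h_def using insert by (intro convex_on_Max) auto
  moreover have "0 \<le> h x \<or> 0 \<le> g j x" if "x \<in> S" for x
    using insert.prems(2)[OF that] insert.hyps by (auto simp: h_def Max_ge_iff)
  ultimately obtain c where c: "0 \<le> c" "c \<le> 1" "\<forall>x\<in>S. 0 \<le> c * h x + (1 - c) * g j x"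
    using gordan_convex_two[of S h "g j"] insert.prems(1) by auto
  define g' where "g' = (\<lambda>i x. c * g i x + (1 - c) * g j x)"
  have "convex_on S (g' i)" if "i \<in> I" for i
    unfolding g'_def using that insert.prems(1) c by (intro convex_on_add convex_on_cmul) auto
  moreover have "\<exists>i\<in>I. 0 \<le> g' i x" if "x \<in> S" for x
  proof -
    have "h x \<in> (\<lambda>i. g i x) ` I"
      unfolding h_def using insert.hyps by (intro Max_in) auto
    then show ?thesis
      using c that unfolding g'_def by force
  qed
  ultimately obtain w where w: "\<forall>i\<in>I. 0 \<le> w i" "sum w I = 1" "\<forall>x\<in>S. 0 \<le> (\<Sum>i\<in>I. w i * g' i x)"
    using insert.IH[of g'] by auto
  \<comment> \<open>Expanding the mixtures, \<open>g j\<close> receives \<open>(1 - c)\<close> times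
    the total weight of \<open>w\<close>, which is 1.\<close>
  define w' where "w' = (\<lambda>i. if i = j then 1 - c else c * w i)"
  have w'_sum: "(\<Sum>i\<in>I. w' i * G i) = c * (\<Sum>i\<in>I. w i * G i)" for G
    unfolding sum_distrib_left using insert.hyps by (intro sum.cong) (auto simp: w'_def)
  have "sum w' (insert j I) = 1"
    using w'_sum[of "\<lambda>_. 1"] w insert.hyps by (simp add: w'_def)
  moreover have "(\<Sum>i\<in>insert j I. w' i * g i x) = (\<Sum>i\<in>I. w i * g' i x)" for x
  proof -
    have "(\<Sum>i\<in>I. w i * g' i x) = c * (\<Sum>i\<in>I. w i * g i x) + (\<Sum>i\<in>I. w i) * ((1 - c) * g j x)"
      unfolding sum_distrib_left sum_distrib_right sum.distrib[symmetric] g'_def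
      by (intro sum.cong) (auto simp: algebra_simps)
    then show ?thesis
      using insert.hyps w w'_sum[of "\<lambda>i. g i x"] by (simp add: w'_def)
  qed
  moreover have "\<forall>i\<in>insert j I. 0 \<le> w' i"
    using w c by (auto simp: w'_def)
  ultimately show ?case
    using w by (intro exI[of _ w']) auto
qed

section \<open>Convex polynomials bounded below\<close>

lemma polynomial_bounded_imp_const:
  fixes q :: "real \<Rightarrow> real"
  assumes "real_polynomial_function q" and bd: "\<And>t. 0 \<le> t \<Longrightarrow> \<bar>q t\<bar> \<le> B"
  shows "q t = q 0"
proof -
  obtain a n where q: "q = (\<lambda>x. \<Sum>i\<le>n. a i * x ^ i)"
    using assms(1) real_polynomial_function_imp_sum by blast
  have "a k = 0" if k: "1 \<le> k" "k \<le> n" for k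
  proof (rule ccontr)
    assume "a k \<noteq> 0"
    then obtain M where M: "\<And>z. M \<le> norm z \<Longrightarrow> B + 1 \<le> norm (q z)"
      using Limits.polyfun_extremal[where c=a and k=k and n=n and B="B + 1"] k unfolding q eventually_at_infinity by auto
    \<comment> \<open>The bound is known on the half-line only, hence the point \<bar>M\<bar>
      instead of M.\<close>
    have "B + 1 \<le> norm (q \<bar>M\<bar>)" by (intro M) simp
    with bd[of "\<bar>M\<bar>"] show False by simp
  qed
  then have "q x = a 0" for x
  proof -
    have "(\<Sum>i\<le>n. a i * x ^ i) = (\<Sum>i\<in>{0}. a i * x ^ i)"
      using \<open>\<And>k. 1 \<le> k \<Longrightarrow> k \<le> n \<Longrightarrow> a k = 0\<close> by (intro sum.mono_neutral_right) (auto simp: Suc_le_eq)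
    then show ?thesis by (simp add: q)
  qed
  then show ?thesis by simp
qed

text \<open>On the ray, \<open>p\<close> lies between \<open>b\<close> and \<open>p y\<close>, so
  its restriction is a bounded one-variable polynomial. The conclusion includes negative
  \<open>t\<close>, which is what permits moving backwards along \<open>d\<close>.\<close>

lemma polynomial_const_on_recession_line:
  fixes p :: "'a::real_normed_vector \<Rightarrow> real"
  assumes "real_polynomial_function p" and lb: "\<And>x. b \<le> p x"
    and le: "\<And>t. 0 \<le> t \<Longrightarrow> p (y + t *\<^sub>R d) \<le> p y"
  shows "p (y + t *\<^sub>R d) = p y"
proof -
  have "polynomial_function (\<lambda>t. y + t *\<^sub>R d)"
    by (intro polynomial_function_add polynomial_function_const polynomial_function_bounded_linear bounded_linear_scaleR_left)
  then have "real_polynomial_function (\<lambda>t. p (y + t *\<^sub>R d))"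
    using real_polynomial_function_compose[of "\<lambda>t. y + t *\<^sub>R d" p] assms(1) by (simp add: o_def)
  moreover have "\<bar>p (y + t *\<^sub>R d)\<bar> \<le> \<bar>b\<bar> + \<bar>p y\<bar>" if "0 \<le> t" for t
    using lb[of "y + t *\<^sub>R d"] le[OF that] by linarith
  ultimately show ?thesis
    using polynomial_bounded_imp_const[of "\<lambda>t. p (y + t *\<^sub>R d)" "\<bar>b\<bar> + \<bar>p y\<bar>" t] by simp
qed

text \<open>Otherwise the points of minimal norm in the sublevel sets escape to infinity along a direction
  in which \<open>p\<close> does not increase, hence is constant; moving back along it decreases the norm.\<close>

lemma convex_polynomial_attains_min:
  fixes p :: "'a::euclidean_space \<Rightarrow> real"
  assumes p: "real_polynomial_function p" and conv: "convex_on UNIV p" and lb: "\<And>x. b \<le> p x"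
  shows "\<exists>u. \<forall>x. p u \<le> p x"
proof -
  have convD: "p (u *\<^sub>R x + v *\<^sub>R y) \<le> u * p x + v * p y" if "0 \<le> u" "0 \<le> v" "u + v = 1" for u v x y
    using conv that by (auto simp: convex_on_def)
  define m where "m = Inf (range p)"
  have bdd: "bdd_below (range p)"
    using lb by (auto simp: bdd_below_def)
  have m_le: "m \<le> p x" for x
    unfolding m_def using bdd by (intro cInf_lower) auto
  have cont: "continuous_on UNIV p"
    using p continuous_real_polymonial_function by (auto intro: continuous_at_imp_continuous_on)
  have ex: "\<exists>y. p y \<le> m + 1 / Suc n \<and> (\<forall>z. p z \<le> m + 1 / Suc n \<longrightarrow> norm y \<le> norm z)" for n
  proof -
    let ?L = "{x. p x \<le> m + 1 / Suc n}"
    have "closed ?L"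
      using cont by (intro closed_Collect_le) auto
    moreover have "?L \<noteq> {}"
    proof -
      have "Inf (range p) < m + 1 / Suc n"
        by (simp add: m_def)
      then obtain x where "p x < m + 1 / Suc n"
        using cInf_lessD[of "range p"] by auto
      then show ?thesis by (auto intro: less_imp_le)
    qed
    ultimately show ?thesis
      using distance_attains_inf[of ?L 0] by auto
  qed
  \<comment> \<open>Minimal norm is what the unbounded case will contradict; an arbitrary minimizing
    sequence would not do.\<close>
  then obtain Y where Y: "\<And>n. p (Y n) \<le> m + 1 / Suc n"
      and Ymin: "\<And>n z. p z \<le> m + 1 / Suc n \<Longrightarrow> norm (Y n) \<le> norm z"
    by metis
  have lim_m: "(\<lambda>n. m + 1 / Suc n) \<longlonglongrightarrow> m"
    using LIMSEQ_inverse_real_of_nat_add[of m] by (simp add: inverse_eq_divide)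
  show ?thesis
  proof (cases "bounded (range Y)")
    case True
    then obtain l r where lr: "strict_mono (r :: nat \<Rightarrow> nat)" "(Y \<circ> r) \<longlonglongrightarrow> l"
      using bounded_imp_convergent_subsequence by blast
    have "(\<lambda>n. p (Y (r n))) \<longlonglongrightarrow> p l"
      using lr(2) cont by (auto simp: o_def continuous_on_def intro: continuous_on_tendsto_compose[OF cont])
    moreover have "(\<lambda>n. m + 1 / Suc (r n)) \<longlonglongrightarrow> m"
      using LIMSEQ_subseq_LIMSEQ[OF lim_m lr(1)] by (simp add: o_def)
    ultimately have "p l \<le> m"
      using Y by (intro LIMSEQ_le) auto
    then show ?thesis
      using m_le order_trans by blast
  next
    case False
    have "\<exists>k. real n < norm (Y k)" for n
      using False by (force simp: bounded_iff not_le)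
    then obtain K where K: "\<And>n. real n < norm (Y (K n))"
      by metis
    define Z where "Z = (\<lambda>n. Y (K n))"
    have Zpos: "0 < norm (Z n)" for n
      using K[of n] unfolding Z_def by linarith
    have Zle: "p (Z n) \<le> m + 1" for n
      using Y[of "K n"] by (simp add: Z_def) (smt (verit) divide_le_eq_1 of_nat_0_le_iff)
    have "bounded (range (\<lambda>n. Z n /\<^sub>R norm (Z n)))"
      using Zpos by (auto simp: bounded_iff intro!: exI[of _ 1])
    then obtain d r where dr: "strict_mono (r :: nat \<Rightarrow> nat)" "((\<lambda>n. Z n /\<^sub>R norm (Z n)) \<circ> r) \<longlonglongrightarrow> d"
      using bounded_imp_convergent_subsequence by blast
    define W where "W = (\<lambda>n. Z (r n))"
    have Wpos: "0 < norm (W n)" and Wle: "p (W n) \<le> m + 1" for n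
      using Zpos Zle by (auto simp: W_def)
    have W: "(\<lambda>n. W n /\<^sub>R norm (W n)) \<longlonglongrightarrow> d"
      using dr by (simp add: o_def W_def)
    have Wn: "real n < norm (W n)" for n
      using K[of "r n"] seq_suble[OF dr(1), of n] by (simp add: W_def Z_def)
    have norm_d: "norm d = 1"
    proof -
      have "(\<lambda>n. norm (W n /\<^sub>R norm (W n))) \<longlonglongrightarrow> norm d"
        using W by (intro tendsto_norm)
      moreover have "norm (W n /\<^sub>R norm (W n)) = 1" for n
        using Wpos[of n] by auto
      ultimately show ?thesis
        by (simp add: LIMSEQ_const_iff)
    qed
    have inv0: "(\<lambda>n. 1 / norm (W n)) \<longlonglongrightarrow> 0"
    proof (rule tendsto_sandwich[of "\<lambda>_. 0" _ _ "\<lambda>n. 1 / real n"])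
      show "\<forall>\<^sub>F n in sequentially. 1 / norm (W n) \<le> 1 / real n"
        using Wn less_imp_le by (intro eventually_sequentiallyI[of 1] divide_left_mono mult_pos_pos Wpos) auto
      show "(\<lambda>n. 1 / real n) \<longlonglongrightarrow> 0"
        by (rule lim_1_over_n)
    qed auto
    \<comment> \<open>Convexity bounds \<open>p\<close> on the segment from \<open>y\<close> to
      \<open>W n\<close>. The point at parameter \<open>t / norm (W n)\<close> tends to
      \<open>y + t d\<close>, while the bound tends to \<open>p y\<close> because
      \<open>p (W n)\<close> stays below \<open>m + 1\<close>.\<close>
    have le: "p (y + t *\<^sub>R d) \<le> p y" if t: "0 \<le> t" for y t
    proof (rule LIMSEQ_le)
      let ?\<tau> = "\<lambda>n. t * (1 / norm (W n))"
      have \<tau>: "?\<tau> \<longlonglongrightarrow> 0"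
        using tendsto_mult_left[OF inv0, of t] by simp
      have "(\<lambda>n. (1 - ?\<tau> n) *\<^sub>R y + t *\<^sub>R (W n /\<^sub>R norm (W n))) \<longlonglongrightarrow> (1 - 0) *\<^sub>R y + t *\<^sub>R d"
        by (intro tendsto_intros \<tau> W)
      then show "(\<lambda>n. p ((1 - ?\<tau> n) *\<^sub>R y + ?\<tau> n *\<^sub>R W n)) \<longlonglongrightarrow> p (y + t *\<^sub>R d)"
        by (intro continuous_on_tendsto_compose[OF cont]) (auto simp: divide_inverse)
      have "(\<lambda>n. (1 - ?\<tau> n) * p y + ?\<tau> n * (m + 1)) \<longlonglongrightarrow> (1 - 0) * p y + 0 * (m + 1)"
        by (intro tendsto_intros \<tau>)
      then show "(\<lambda>n. (1 - ?\<tau> n) * p y + ?\<tau> n * (m + 1)) \<longlonglongrightarrow> p y"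
        by simp
      obtain N where N: "t \<le> real N"
        using real_arch_simple by blast
      have "p ((1 - ?\<tau> n) *\<^sub>R y + ?\<tau> n *\<^sub>R W n) \<le> (1 - ?\<tau> n) * p y + ?\<tau> n * (m + 1)" if "n \<ge> N" for n
      proof -
        have \<tau>01: "0 \<le> ?\<tau> n" "?\<tau> n \<le> 1"
          using t N that Wn[of n] Wpos[of n] by (auto simp: divide_le_eq)
        then have "p ((1 - ?\<tau> n) *\<^sub>R y + ?\<tau> n *\<^sub>R W n) \<le> (1 - ?\<tau> n) * p y + ?\<tau> n * p (W n)"
          by (intro convD) auto
        also have "\<dots> \<le> (1 - ?\<tau> n) * p y + ?\<tau> n * (m + 1)"
          using Wle \<tau>01 by (intro add_left_mono mult_left_mono) auto
        finally show ?thesis .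
      qed
      then show "\<exists>N. \<forall>n\<ge>N. p ((1 - ?\<tau> n) *\<^sub>R y + ?\<tau> n *\<^sub>R W n) \<le> (1 - ?\<tau> n) * p y + ?\<tau> n * (m + 1)"
        by blast
    qed
    have const: "p (y + t *\<^sub>R d) = p y" for y t
      using polynomial_const_on_recession_line[of p b y d t, OF p lb le] by simp
    have "(\<lambda>n. (W n /\<^sub>R norm (W n)) \<bullet> d) \<longlonglongrightarrow> d \<bullet> d"
      by (intro tendsto_intros W)
    then have "\<forall>\<^sub>F n in sequentially. 0 < (W n /\<^sub>R norm (W n)) \<bullet> d"
      using norm_d by (intro order_tendstoD) (auto simp: dot_square_norm)
    then obtain n where "0 < (W n /\<^sub>R norm (W n)) \<bullet> d"
      by (auto simp: eventually_sequentially)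
    then have pos: "0 < W n \<bullet> d"
      using Wpos[of n] by (simp add: zero_less_mult_iff)
    \<comment> \<open>\<open>W n\<close> without its component along the unit vector
      \<open>d\<close>: same value of \<open>p\<close>, strictly smaller norm.\<close>
    define z where "z = W n + (- (W n \<bullet> d)) *\<^sub>R d"
    have "d \<bullet> d = 1"
      using norm_d by (simp add: dot_square_norm)
    then have "z \<bullet> z = W n \<bullet> W n - (W n \<bullet> d)\<^sup>2"
      unfolding z_def by (simp add: inner_add_left inner_add_right inner_commute power2_eq_square algebra_simps)
    also have "\<dots> < W n \<bullet> W n"
      using pos by simp
    finally have "norm z < norm (W n)"
      by (simp add: norm_lt)
    moreover have "p z = p (W n)"
      unfolding z_def by (rule const)
    ultimately show ?thesis
      using Ymin[of z "K (r n)"] Y[of "K (r n)"] by (auto simp: W_def Z_def)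
  qed
qed

section \<open>Gram factorization of the Taylor kernel\<close>

text \<open>Cholesky factorization by induction: splitting off the last variable leaves the Schur
  complement \<open>B\<close>, which is again positive semidefinite. Since division by zero yields
  0, the same formulas serve a vanishing pivot \<open>a\<close>, provided the last column then
  vanishes too.\<close>

lemma psd_gram:
  fixes A :: "nat \<Rightarrow> nat \<Rightarrow> real"
  assumes "\<And>i j. i < N \<Longrightarrow> j < N \<Longrightarrow> A i j = A j i"
    and "\<And>x. 0 \<le> (\<Sum>i<N. \<Sum>j<N. A i j * x i * x j)"
  shows "\<exists>L. \<forall>i<N. \<forall>j<N. A i j = (\<Sum>m<N. L m i * L m j)"
  using assms
proof (induction N arbitrary: A)
  case 0
  then show ?case by simp
next
  case (Suc N)
  define a where "a = A N N"
  define quad where "quad = (\<lambda>x. \<Sum>i<N. \<Sum>j<N. A i j * x i * x j)"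
  define lin where "lin = (\<lambda>x. \<Sum>i<N. A i N * x i)"
  have expand: "(\<Sum>i<Suc N. \<Sum>j<Suc N. A i j * x i * x j) = quad x + 2 * lin x * x N + a * (x N)\<^sup>2" for x
  proof -
    have "(\<Sum>j<N. A N j * x N * x j) = lin x * x N"
      unfolding lin_def sum_distrib_right using Suc.prems(1) by (intro sum.cong) auto
    moreover have "(\<Sum>i<N. A i N * x i * x N) = lin x * x N"
      by (simp add: lin_def sum_distrib_right)
    ultimately show ?thesis
      by (simp add: quad_def a_def sum.distrib power2_eq_square)
  qed
  have nonneg: "0 \<le> quad x + 2 * lin x * y + a * y\<^sup>2" for x y
  proof -
    have "quad (x(N := y)) = quad x" "lin (x(N := y)) = lin x"
      unfolding quad_def lin_def by (auto intro!: sum.cong)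
    moreover have "0 \<le> quad (x(N := y)) + 2 * lin (x(N := y)) * (x(N := y)) N + a * ((x(N := y)) N)\<^sup>2"
      using Suc.prems(2)[of "x(N := y)"] unfolding expand .
    ultimately show ?thesis
      by (simp only: fun_upd_same)
  qed
  have a: "0 \<le> a"
    using nonneg[of "\<lambda>_. 0" 1] by (simp add: quad_def lin_def)
  \<comment> \<open>With \<open>a = 0\<close> the nonnegative expression is affine in
    \<open>y\<close>, so its slope is 0; the \<open>y\<close> chosen below would give it the value
    -1.\<close>
  have zero: "lin x = 0" if "a = 0" for x
  proof (rule ccontr)
    assume "lin x \<noteq> 0"
    then show False
      using nonneg[of x "- (quad x + 1) / (2 * lin x)"] that by simp
  qed
  have A0: "A i N = 0" if "a = 0" "i < N" for i
    using zero[OF that(1), of "\<lambda>j. if j = i then 1 else 0"] that(2) by (simp add: lin_def if_distrib cong: if_cong)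
  define B where "B = (\<lambda>i j. A i j - A i N * A j N / a)"
  have "B i j = B j i" if "i < N" "j < N" for i j
    using Suc.prems(1) that by (simp add: B_def)
  moreover have "0 \<le> (\<Sum>i<N. \<Sum>j<N. B i j * x i * x j)" for x
  proof -
    have "(lin x)\<^sup>2 / a = (\<Sum>i<N. \<Sum>j<N. A i N * A j N / a * x i * x j)"
      unfolding lin_def power2_eq_square sum_product sum_divide_distrib
      by (intro sum.cong refl) (simp add: algebra_simps)
    then have "(\<Sum>i<N. \<Sum>j<N. B i j * x i * x j) = quad x - (lin x)\<^sup>2 / a"
      by (simp add: B_def quad_def left_diff_distrib sum_subtractf)
    \<comment> \<open>For positive \<open>a\<close>, \<open>- lin x / a\<close> minimizes the
      quadratic in the last variable.\<close>
    also have "\<dots> = quad x + 2 * lin x * (- lin x / a) + a * (- lin x / a)\<^sup>2"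
      by (cases "a = 0") (auto simp: field_simps power2_eq_square)
    finally show ?thesis
      using nonneg[of x "- lin x / a"] by (simp only:)
  qed
  ultimately obtain L where L: "\<And>i j. i < N \<Longrightarrow> j < N \<Longrightarrow> B i j = (\<Sum>m<N. L m i * L m j)"
    using Suc.IH[of B] by auto
  \<comment> \<open>The rows of \<open>L\<close> are padded by a zero in column \<open>N\<close>;
    the new last row is the last column of \<open>A\<close> divided by \<open>sqrt a\<close>, whose
    own products restore the part subtracted in \<open>B\<close>.\<close>
  define L' where "L' = (\<lambda>m i. if m < N then if i < N then L m i else 0 else A i N / sqrt a)"
  have "A i j = (\<Sum>m<Suc N. L' m i * L' m j)" if ij: "i < Suc N" "j < Suc N" for i j
  proof -
    have "(\<Sum>m<N. L' m i * L' m j) = (if i < N \<and> j < N then B i j else 0)"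
      using L by (auto simp: L'_def)
    then have "(\<Sum>m<Suc N. L' m i * L' m j) = (if i < N \<and> j < N then B i j else 0) + A i N * A j N / a"
      using a by (simp add: L'_def)
    moreover have "A i j = (if i < N \<and> j < N then B i j else 0) + A i N * A j N / a"
    proof (cases "i < N \<and> j < N")
      case True
      then show ?thesis by (simp add: B_def)
    next
      case False
      then consider "i = N" "j = N" | "i = N" "j < N" | "i < N" "j = N"
        using ij by linarith
      then show ?thesis
        by cases (use A0 Suc.prems(1)[of N j] in \<open>auto simp: a_def\<close>)
    qed
    ultimately show ?thesis
      by (simp only:)
  qed
  then show ?case by (intro exI[of _ L'] allI impI)
qed

text \<open>Taylor's formula enters in this form: no integral is evaluated, an explicit double
  primitive of the second derivative is compared with the function instead.\<close>

lemma eq_at_1_of_deriv2: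
  fixes \<phi> \<psi> :: "real \<Rightarrow> real"
  assumes "\<And>t. (\<phi> has_real_derivative \<phi>' t) (at t)" "\<And>t. (\<phi>' has_real_derivative \<phi>'' t) (at t)"
    and "\<And>t. (\<psi> has_real_derivative \<psi>' t) (at t)" "\<And>t. (\<psi>' has_real_derivative \<phi>'' t) (at t)"
    and "\<phi> 0 = \<psi> 0" "\<phi>' 0 = \<psi>' 0"
  shows "\<phi> t = \<psi> t"
proof -
  have "((\<lambda>t. \<phi>' t - \<psi>' t) has_real_derivative 0) (at t)" for t
    using DERIV_diff[OF assms(2,4)] by simp
  then have "\<phi>' t - \<psi>' t = \<phi>' 0 - \<psi>' 0" for t
    using DERIV_isconst_all[of "\<lambda>t. \<phi>' t - \<psi>' t" t 0] by simp
  then have eq: "\<phi>' t = \<psi>' t" for t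
    using assms(6) by simp
  have "((\<lambda>t. \<phi> t - \<psi> t) has_real_derivative 0) (at t)" for t
    using DERIV_diff[OF assms(1,3)] eq by simp
  then have "\<phi> t - \<psi> t = \<phi> 0 - \<psi> 0" for t
    using DERIV_isconst_all[of "\<lambda>t. \<phi> t - \<psi> t" t 0] by simp
  then show ?thesis
    using assms(5) by simp
qed

text \<open>\<psi> arises by expanding the square and integrating each term twice from 0. At
  \<open>t = 1\<close> it is the quadratic form of the matrix with entries 1 /
  ((k+l+1)(k+l+2)).\<close>

lemma DERIV_double_primitive_square:
  fixes c :: "nat \<Rightarrow> real" and N :: nat
  defines "\<psi> \<equiv> \<lambda>t. \<Sum>k<N. \<Sum>l<N. c k * c l / ((real (k + l) + 1) * (real (k + l) + 2)) * t ^ (k + l + 2)"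
    and "\<psi>' \<equiv> \<lambda>t. \<Sum>k<N. \<Sum>l<N. c k * c l / (real (k + l) + 1) * t ^ (k + l + 1)"
  shows "(\<psi> has_real_derivative \<psi>' t) (at t)"
    and "(\<psi>' has_real_derivative (\<Sum>k<N. c k * t ^ k)\<^sup>2) (at t)"
proof -
  \<comment> \<open>Used from right to left: the factor produced by differentiating the power is
    reinserted, so that \<open>DERIV_pow\<close> fits.\<close>
  have cancel: "a / ((r + 1) * (r + 2)) * ((r + 2) * T) = a / (r + 1) * T" "a / (r + 1) * ((r + 1) * T) = a * T"
    if "0 \<le> r" for a r T :: real
    using that by (auto simp: divide_simps)
  have "((\<lambda>t. c k * c l / ((real (k + l) + 1) * (real (k + l) + 2)) * t ^ (k + l + 2)) has_real_derivative
      c k * c l / (real (k + l) + 1) * t ^ (k + l + 1)) (at t)" for k l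
    unfolding cancel(1)[OF of_nat_0_le_iff, symmetric]
    by (rule DERIV_cmult) (use DERIV_pow[of "k + l + 2" t] in \<open>simp add: add_ac\<close>)
  then show "(\<psi> has_real_derivative \<psi>' t) (at t)"
    unfolding \<psi>_def \<psi>'_def by (intro DERIV_sum)
  have "((\<lambda>t. c k * c l / (real (k + l) + 1) * t ^ (k + l + 1)) has_real_derivative
      c k * c l * t ^ (k + l)) (at t)" for k l
    unfolding cancel(2)[OF of_nat_0_le_iff[of "k + l"], of "c k * c l" "t ^ (k + l)", symmetric]
    by (rule DERIV_cmult) (use DERIV_pow[of "k + l + 1" t] in \<open>simp add: add_ac\<close>)
  moreover have "c k * c l * t ^ (k + l) = c k * t ^ k * (c l * t ^ l)" for k l
    by (simp add: power_add)
  ultimately have "((\<lambda>t. c k * c l / (real (k + l) + 1) * t ^ (k + l + 1)) has_real_derivative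
      c k * t ^ k * (c l * t ^ l)) (at t)" for k l
    by simp
  then show "(\<psi>' has_real_derivative (\<Sum>k<N. c k * t ^ k)\<^sup>2) (at t)"
    unfolding \<psi>'_def power2_eq_square sum_product by (intro DERIV_sum)
qed

text \<open>The entry is the integral of (1 - t) t^(i+j) over [0,1]. Its quadratic form is
  nonnegative because it equals \<open>\<psi> 1\<close>, where \<psi> and its derivative start at 0
  and the second derivative is a square.\<close>

lemma double_primitive_gram:
  "\<exists>L :: nat \<Rightarrow> nat \<Rightarrow> real. \<forall>i<N. \<forall>j<N.
     1 / ((real (i + j) + 1) * (real (i + j) + 2)) = (\<Sum>m<N. L m i * L m j)"
proof (rule psd_gram)
  fix c :: "nat \<Rightarrow> real"
  define \<psi> where "\<psi> = (\<lambda>t. \<Sum>k<N. \<Sum>l<N. c k * c l / ((real (k + l) + 1) * (real (k + l) + 2)) * t ^ (k + l + 2))"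
  define \<psi>' where "\<psi>' = (\<lambda>t. \<Sum>k<N. \<Sum>l<N. c k * c l / (real (k + l) + 1) * t ^ (k + l + 1))"
  have D: "(\<psi> has_real_derivative \<psi>' t) (at t)"
    "(\<psi>' has_real_derivative (\<Sum>k<N. c k * t ^ k)\<^sup>2) (at t)" for t
    unfolding \<psi>_def \<psi>'_def by (rule DERIV_double_primitive_square)+
  have "0 \<le> \<psi>' t" if "0 \<le> t" for t
  proof -
    have "\<psi>' 0 \<le> \<psi>' t"
      using that by (rule DERIV_nonneg_imp_nondecreasing) (rule exI, rule conjI, rule D(2), rule zero_le_power2)
    then show ?thesis by (simp add: \<psi>'_def)
  qed
  then have "\<exists>y. (\<psi> has_real_derivative y) (at t) \<and> 0 \<le> y" if "0 \<le> t" for t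
    using D(1)[of t] that by auto
  then have "\<psi> 0 \<le> \<psi> 1"
    by (rule DERIV_nonneg_imp_nondecreasing[OF zero_le_one])
  then show "0 \<le> (\<Sum>i<N. \<Sum>j<N. 1 / ((real (i + j) + 1) * (real (i + j) + 2)) * c i * c j)"
    by (simp add: \<psi>_def)
qed (simp add: add.commute)

section \<open>Gradients and Hessians of polynomials\<close>

text \<open>The partial derivatives are again polynomials, so a second application reaches the
  Hessian.\<close>

lemma real_polynomial_function_has_gradient:
  fixes p :: "real ^ 'n \<Rightarrow> real"
  assumes "real_polynomial_function p"
  shows "\<exists>g. (\<forall>i. real_polynomial_function (g i)) \<and>
    (\<forall>x. (p has_derivative (\<lambda>h. \<Sum>i\<in>UNIV. g i x * h $ i)) (at x))"
  using assms
proof induction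
  case (linear f)
  have "f h = (\<Sum>i\<in>UNIV. f (axis i 1) * h $ i)" for h
  proof -
    have "f h = f (\<Sum>i\<in>UNIV. h $ i *\<^sub>R axis i 1)"
      using basis_expansion[of h] by (simp add: scalar_mult_eq_scaleR)
    also have "\<dots> = (\<Sum>i\<in>UNIV. f (axis i 1) * h $ i)"
      using bounded_linear.linear[OF linear] by (simp add: linear_sum linear_cmul mult.commute)
    finally show ?thesis .
  qed
  then have "f = (\<lambda>h. \<Sum>i\<in>UNIV. f (axis i 1) * h $ i)"
    by (rule ext)
  then have "(f has_derivative (\<lambda>h. \<Sum>i\<in>UNIV. f (axis i 1) * h $ i)) (at x)" for x
    using bounded_linear_imp_has_derivative[OF linear, of "at x"] by (simp only:)
  then show ?case
    by (intro exI[of _ "\<lambda>i x. f (axis i 1)"]) auto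
next
  case (const c)
  then show ?case by (intro exI[of _ "\<lambda>i x. 0"]) auto
next
  case (add f g)
  then obtain F G where F: "\<forall>i. real_polynomial_function (F i)" "\<forall>x. (f has_derivative (\<lambda>h. \<Sum>i\<in>UNIV. F i x * h $ i)) (at x)"
    and G: "\<forall>i. real_polynomial_function (G i)" "\<forall>x. (g has_derivative (\<lambda>h. \<Sum>i\<in>UNIV. G i x * h $ i)) (at x)"
    by blast
  have "((\<lambda>x. f x + g x) has_derivative (\<lambda>h. \<Sum>i\<in>UNIV. (F i x + G i x) * h $ i)) (at x)" for x
    using has_derivative_add[OF F(2)[rule_format] G(2)[rule_format], of x]
    by (simp add: distrib_right sum.distrib)
  then show ?case
    using F(1) G(1) by (intro exI[of _ "\<lambda>i x. F i x + G i x"]) auto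
next
  case (mult f g)
  then obtain F G where F: "\<forall>i. real_polynomial_function (F i)" "\<forall>x. (f has_derivative (\<lambda>h. \<Sum>i\<in>UNIV. F i x * h $ i)) (at x)"
    and G: "\<forall>i. real_polynomial_function (G i)" "\<forall>x. (g has_derivative (\<lambda>h. \<Sum>i\<in>UNIV. G i x * h $ i)) (at x)"
    by blast
  have "((\<lambda>x. f x * g x) has_derivative (\<lambda>h. \<Sum>i\<in>UNIV. (f x * G i x + F i x * g x) * h $ i)) (at x)" for x
  proof -
    have "(\<Sum>i\<in>UNIV. (f x * G i x + F i x * g x) * h $ i)
        = f x * (\<Sum>i\<in>UNIV. G i x * h $ i) + (\<Sum>i\<in>UNIV. F i x * h $ i) * g x" for h
      by (simp add: sum_distrib_left sum_distrib_right sum.distrib[symmetric] algebra_simps)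
    then show ?thesis
      using has_derivative_mult[OF F(2)[rule_format] G(2)[rule_format], of x] by (simp only:)
  qed
  then show ?case
    using F(1) G(1) mult.hyps by (intro exI[of _ "\<lambda>i x. f x * G i x + F i x * g x"])
      (auto intro!: real_polynomial_function.intros(3,4))
qed

lemma gradient_eq:
  assumes "(p has_derivative (\<lambda>h. \<Sum>i\<in>UNIV. g i * h $ i)) (at x)"
  shows "gradient p x = (\<chi> i. g i)"
  unfolding gradient_def frechet_derivative_at[OF assms, symmetric]
  by (simp add: vec_eq_iff axis_def if_distrib cong: if_cong)

lemma hessian_eq:
  fixes p :: "real ^ 'n \<Rightarrow> real"
  assumes g: "\<And>x. (p has_derivative (\<lambda>h. \<Sum>i\<in>UNIV. g i x * h $ i)) (at x)"
    and G: "\<And>i. (g i has_derivative (\<lambda>h. \<Sum>j\<in>UNIV. G i j * h $ j)) (at x)"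
  shows "hessian p x $ a $ b = G a b"
proof -
  have "gradient p = (\<lambda>x. \<chi> i. g i x)"
    using gradient_eq[OF g] by auto
  moreover have "((\<lambda>x. \<chi> i. g i x) has_derivative (\<lambda>h. \<chi> i. \<Sum>j\<in>UNIV. G i j * h $ j)) (at x)"
    using G by (subst has_derivative_componentwise_within) (auto simp: Basis_vec_def inner_axis)
  ultimately show ?thesis
    unfolding hessian_def jacobian_def
    by (simp add: frechet_derivative_at[symmetric] matrix_def axis_def if_distrib cong: if_cong)
qed

lemma real_polynomial_function_derivatives:
  fixes p :: "real ^ 'n \<Rightarrow> real"
  assumes "real_polynomial_function p"
  shows "(p has_derivative (\<lambda>h. \<Sum>i\<in>UNIV. gradient p x $ i * h $ i)) (at x)"
    and "((\<lambda>x. gradient p x $ i) has_derivative (\<lambda>h. \<Sum>j\<in>UNIV. hessian p x $ i $ j * h $ j)) (at x)"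
proof -
  obtain g where g: "\<And>i. real_polynomial_function (g i)"
      "\<And>x. (p has_derivative (\<lambda>h. \<Sum>i\<in>UNIV. g i x * h $ i)) (at x)"
    using real_polynomial_function_has_gradient[OF assms] by blast
  have "\<forall>i. \<exists>G. \<forall>x. (g i has_derivative (\<lambda>h. \<Sum>j\<in>UNIV. G j x * h $ j)) (at x)"
    using real_polynomial_function_has_gradient[OF g(1)] by blast
  then obtain G where G: "\<And>i x. (g i has_derivative (\<lambda>h. \<Sum>j\<in>UNIV. G i j x * h $ j)) (at x)"
    by metis
  have grad: "gradient p x $ i = g i x" for i x
    using gradient_eq[OF g(2)] by simp
  have hess: "hessian p x $ i $ j = G i j x" for i j x
    using hessian_eq[of p g "\<lambda>i j. G i j x" x, OF g(2) G] .
  show "(p has_derivative (\<lambda>h. \<Sum>i\<in>UNIV. gradient p x $ i * h $ i)) (at x)"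
    using g(2) by (simp add: grad)
  show "((\<lambda>x. gradient p x $ i) has_derivative (\<lambda>h. \<Sum>j\<in>UNIV. hessian p x $ i $ j * h $ j)) (at x)"
    using G by (simp add: grad hess)
qed

lemma hessian_add:
  fixes p q :: "real ^ 'n \<Rightarrow> real"
  assumes "real_polynomial_function p" "real_polynomial_function q"
  shows "hessian (\<lambda>x. p x + q x) x $ a $ b = hessian p x $ a $ b + hessian q x $ a $ b"
proof (rule hessian_eq[where g="\<lambda>i x. gradient p x $ i + gradient q x $ i"
      and G="\<lambda>i j. hessian p x $ i $ j + hessian q x $ i $ j"])
  note D = real_polynomial_function_derivatives
  show "((\<lambda>x. p x + q x) has_derivative (\<lambda>h. \<Sum>i\<in>UNIV. (gradient p x $ i + gradient q x $ i) * h $ i)) (at x)" for x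
    using has_derivative_add[OF D(1)[OF assms(1), of x] D(1)[OF assms(2), of x]]
    by (simp add: distrib_right sum.distrib)
  show "((\<lambda>x. gradient p x $ i + gradient q x $ i) has_derivative
      (\<lambda>h. \<Sum>j\<in>UNIV. (hessian p x $ i $ j + hessian q x $ i $ j) * h $ j)) (at x)" for i
    using has_derivative_add[OF D(2)[OF assms(1), of i x] D(2)[OF assms(2), of i x]]
    by (simp add: distrib_right sum.distrib)
qed

lemma hessian_cmult:
  fixes p :: "real ^ 'n \<Rightarrow> real"
  assumes "real_polynomial_function p"
  shows "hessian (\<lambda>x. c * p x) x $ a $ b = c * hessian p x $ a $ b"
proof (rule hessian_eq[where g="\<lambda>i x. c * gradient p x $ i"
      and G="\<lambda>i j. c * hessian p x $ i $ j"])
  note D = real_polynomial_function_derivatives[OF assms]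
  show "((\<lambda>x. c * p x) has_derivative (\<lambda>h. \<Sum>i\<in>UNIV. (c * gradient p x $ i) * h $ i)) (at x)" for x
    using has_derivative_mult_right[OF D(1)[of x], of c] by (simp add: sum_distrib_left mult.assoc)
  show "((\<lambda>x. c * gradient p x $ i) has_derivative (\<lambda>h. \<Sum>j\<in>UNIV. (c * hessian p x $ i $ j) * h $ j)) (at x)" for i
    using has_derivative_mult_right[OF D(2)[of i x], of c] by (simp add: sum_distrib_left mult.assoc)
qed

lemma sos_convex_const: "sos_convex (\<lambda>x :: real ^ 'n. c)"
proof -
  have "hessian (\<lambda>x :: real ^ 'n. c) x $ a $ b = 0" for x a b
    by (rule hessian_eq[where g="\<lambda>_ _. 0" and G="\<lambda>_ _. 0"]) simp_all
  then show ?thesis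
    unfolding sos_convex_def
    by (intro conjI real_polynomial_function.intros(2) exI[of _ "0::nat"] exI[of _ "\<lambda>_ _ _. 0"]) simp_all
qed

text \<open>The factors are placed side by side: the block matrix [H K] times its transpose is the
  sum of the two products.\<close>

lemma sos_convex_add:
  fixes p q :: "real ^ 'n \<Rightarrow> real"
  assumes "sos_convex p" "sos_convex q"
  shows "sos_convex (\<lambda>x. p x + q x)"
proof -
  obtain s :: nat and H where H: "\<And>a j. j < s \<Longrightarrow> real_polynomial_function (H a j)"
      "\<And>x a b. hessian p x $ a $ b = (\<Sum>j<s. H a j x * H b j x)"
    using assms(1) unfolding sos_convex_def by blast
  obtain t :: nat and K where K: "\<And>a j. j < t \<Longrightarrow> real_polynomial_function (K a j)"
      "\<And>x a b. hessian q x $ a $ b = (\<Sum>j<t. K a j x * K b j x)"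
    using assms(2) unfolding sos_convex_def by blast
  define M where "M = (\<lambda>a j. if j < s then H a j else K a (j - s))"
  have pq: "real_polynomial_function p" "real_polynomial_function q"
    using assms unfolding sos_convex_def by auto
  have "hessian (\<lambda>x. p x + q x) x $ a $ b = (\<Sum>j<s + t. M a j x * M b j x)" for x a b
  proof -
    have "(\<Sum>j<s + t. M a j x * M b j x) = (\<Sum>j<s. M a j x * M b j x) + (\<Sum>j<t. M a (s + j) x * M b (s + j) x)"
      by (induction t) (auto simp: M_def)
    then show ?thesis
      by (simp add: hessian_add[OF pq] H(2) K(2) M_def)
  qed
  moreover have "real_polynomial_function (M a j)" if "j < s + t" for a j
    using that H(1)[of j a] K(1)[of "j - s" a] by (simp add: M_def)
  ultimately show ?thesis
    unfolding sos_convex_def using pq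
    by (intro conjI exI[of _ "s + t"] exI[of _ M]) (simp_all add: real_polynomial_function.intros(3))
qed

lemma sos_convex_cmult:
  fixes p :: "real ^ 'n \<Rightarrow> real"
  assumes "sos_convex p" "0 \<le> c"
  shows "sos_convex (\<lambda>x. c * p x)"
proof -
  obtain s :: nat and H where H: "\<And>a j. j < s \<Longrightarrow> real_polynomial_function (H a j)"
      "\<And>x a b. hessian p x $ a $ b = (\<Sum>j<s. H a j x * H b j x)"
    using assms(1) unfolding sos_convex_def by blast
  have p: "real_polynomial_function p"
    using assms unfolding sos_convex_def by auto
  have "hessian (\<lambda>x. c * p x) x $ a $ b = (\<Sum>j<s. (sqrt c * H a j x) * (sqrt c * H b j x))" for x a b
  proof -
    have "(sqrt c * H a j x) * (sqrt c * H b j x) = (sqrt c * sqrt c) * (H a j x * H b j x)" for j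
      by (simp only: mult_ac)
    then have "(sqrt c * H a j x) * (sqrt c * H b j x) = c * (H a j x * H b j x)" for j
      unfolding real_sqrt_mult_self abs_of_nonneg[OF assms(2)] .
    then show ?thesis
      by (simp only: hessian_cmult[OF p] H(2) sum_distrib_left)
  qed
  then show ?thesis
    unfolding sos_convex_def using p H(1)
    by (intro conjI exI[of _ s] exI[of _ "\<lambda>a j x. sqrt c * H a j x"] allI impI real_polynomial_function.intros(4) real_polynomial_function.intros(2)) simp_all
qed

lemma sos_convex_sum:
  assumes "finite I" "\<And>i. i \<in> I \<Longrightarrow> sos_convex (p i)"
  shows "sos_convex (\<lambda>x. \<Sum>i\<in>I. p i x)"
  using assms by (induction I rule: finite_induct) (simp_all add: sos_convex_add sos_convex_const)

section \<open>Nonnegative SOS-convex polynomials\<close>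

text \<open>Separates the powers of \<open>t\<close> from polynomial coefficients in
  \<open>x\<close>, with a length \<open>N\<close> independent of \<open>x\<close>. Integration in
  \<open>t\<close> then produces numbers only, and polynomials in \<open>x\<close> survive as the
  bases of the squares.\<close>

lemma real_polynomial_function_along_line:
  fixes p :: "'a::real_normed_vector \<Rightarrow> real"
  assumes "real_polynomial_function p"
  shows "\<exists>N c. (\<forall>k. real_polynomial_function (c k)) \<and>
    (\<forall>x t. p (u + t *\<^sub>R (x - u)) = (\<Sum>k<N::nat. c k x * t ^ k))"
  using assms
proof induction
  case (linear f)
  then have poly: "real_polynomial_function (\<lambda>x. f x - f u)"
    by (intro real_polynomial_function_diff real_polynomial_function.intros(1,2))
  interpret bounded_linear f by fact
  have "f (u + t *\<^sub>R (x - u)) = (\<Sum>k<2. (if k = 0 then f u else f x - f u) * t ^ k)" for x t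
    by (simp add: add diff scaleR numeral_2_eq_2)
  moreover have "real_polynomial_function (\<lambda>x. if k = 0 then f u else f x - f u)" for k :: nat
    using poly by (cases "k = 0") (auto intro: real_polynomial_function.intros)
  ultimately show ?case
    by (intro exI[of _ "2::nat"] exI[of _ "\<lambda>k x. if k = 0 then f u else f x - f u"]) auto
next
  case (const a)
  then show ?case
    by (intro exI[of _ "1::nat"] exI[of _ "\<lambda>_ _. a"]) auto
next
  case (add f g)
  from add.IH(1) obtain N c where "\<forall>k. real_polynomial_function (c k)"
      "\<forall>x t. f (u + t *\<^sub>R (x - u)) = (\<Sum>k<N::nat. c k x * t ^ k)"
    by (elim exE conjE) (rule that)
  note f = this[rule_format]
  from add.IH(2) obtain M d where "\<forall>k. real_polynomial_function (d k)"
      "\<forall>x t. g (u + t *\<^sub>R (x - u)) = (\<Sum>k<M::nat. d k x * t ^ k)"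
    by (elim exE conjE) (rule that)
  note g = this[rule_format]
  define e where "e = (\<lambda>k x. (if k < N then c k x else 0) + (if k < M then d k x else 0))"
  have "real_polynomial_function (e k)" for k
    unfolding e_def using f(1) g(1) by (cases "k < N"; cases "k < M") (auto intro: real_polynomial_function.intros)
  moreover have "(\<Sum>k<N + M. e k x * t ^ k) = (\<Sum>k<N. c k x * t ^ k) + (\<Sum>k<M. d k x * t ^ k)" for x t
  proof -
    have "(\<Sum>k<N + M. (if k < N then c k x else 0) * t ^ k) = (\<Sum>k<N. c k x * t ^ k)"
      by (rule sum.mono_neutral_cong_right) auto
    moreover have "(\<Sum>k<N + M. (if k < M then d k x else 0) * t ^ k) = (\<Sum>k<M. d k x * t ^ k)"
      by (rule sum.mono_neutral_cong_right) auto
    ultimately show ?thesis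
      by (simp only: e_def distrib_right sum.distrib)
  qed
  ultimately show ?case
    unfolding f(2) g(2) by (intro exI[of _ "N + M"] exI[of _ e]) auto
next
  case (mult f g)
  from mult.IH(1) obtain N c where "\<forall>k. real_polynomial_function (c k)"
      "\<forall>x t. f (u + t *\<^sub>R (x - u)) = (\<Sum>k<N::nat. c k x * t ^ k)"
    by (elim exE conjE) (rule that)
  note f = this[rule_format]
  from mult.IH(2) obtain M d where "\<forall>k. real_polynomial_function (d k)"
      "\<forall>x t. g (u + t *\<^sub>R (x - u)) = (\<Sum>k<M::nat. d k x * t ^ k)"
    by (elim exE conjE) (rule that)
  note g = this[rule_format]
  define I where "I = {..<N} \<times> {..<M}"
  \<comment> \<open>Coefficient \<open>k\<close> of the Cauchy product; \<open>N + M\<close> terms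
    suffice since all index sums stay below that.\<close>
  define e where "e = (\<lambda>k x. \<Sum>ij | ij \<in> I \<and> fst ij + snd ij = k. c (fst ij) x * d (snd ij) x)"
  have "finite I"
    by (simp add: I_def)
  then have "real_polynomial_function (e k)" for k
    unfolding e_def using f(1) g(1)
    by (intro real_polynomial_function_sum real_polynomial_function.intros(4)) auto
  moreover have "(\<Sum>k<N + M. e k x * t ^ k) = (\<Sum>k<N. c k x * t ^ k) * (\<Sum>k<M. d k x * t ^ k)" for x t
  proof -
    have "(\<Sum>k<N + M. e k x * t ^ k)
        = (\<Sum>k<N + M. \<Sum>ij | ij \<in> I \<and> fst ij + snd ij = k. c (fst ij) x * d (snd ij) x * t ^ (fst ij + snd ij))"
      unfolding e_def sum_distrib_right by (intro sum.cong refl) auto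
    also have "\<dots> = (\<Sum>ij\<in>I. c (fst ij) x * d (snd ij) x * t ^ (fst ij + snd ij))"
      using \<open>finite I\<close> by (intro sum.group) (auto simp: I_def)
    also have "\<dots> = (\<Sum>k<N. c k x * t ^ k) * (\<Sum>k<M. d k x * t ^ k)"
      unfolding sum_product sum.cartesian_product I_def
      by (intro sum.cong refl) (auto simp: power_add)
    finally show ?thesis .
  qed
  ultimately show ?case
    unfolding f(2) g(2) by (intro exI[of _ "N + M"] exI[of _ e]) auto
qed

lemma DERIV_along_line:
  fixes p :: "real ^ 'n \<Rightarrow> real"
  assumes "real_polynomial_function p"
  shows "((\<lambda>t. p (u + t *\<^sub>R d)) has_real_derivative (\<Sum>i\<in>UNIV. gradient p (u + t *\<^sub>R d) $ i * d $ i)) (at t)"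
    and "((\<lambda>t. \<Sum>i\<in>UNIV. gradient p (u + t *\<^sub>R d) $ i * d $ i) has_real_derivative
      (\<Sum>i\<in>UNIV. \<Sum>j\<in>UNIV. hessian p (u + t *\<^sub>R d) $ i $ j * d $ i * d $ j)) (at t)"
proof -
  have line: "((\<lambda>t. u + t *\<^sub>R d) has_derivative (\<lambda>h. h *\<^sub>R d)) (at t)"
    by (auto intro!: derivative_eq_intros)
  have chain: "((\<lambda>t. f (u + t *\<^sub>R d)) has_real_derivative (\<Sum>i\<in>UNIV. g i * d $ i)) (at t)"
    if "(f has_derivative (\<lambda>h. \<Sum>i\<in>UNIV. g i * h $ i)) (at (u + t *\<^sub>R d))" for f :: "real ^ 'n \<Rightarrow> real" and g
    unfolding has_field_derivative_def
    using has_derivative_compose[OF line that]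
    by (rule has_derivative_eq_rhs) (auto simp: fun_eq_iff sum_distrib_left mult_ac)
  note D = real_polynomial_function_derivatives[OF assms]
  show "((\<lambda>t. p (u + t *\<^sub>R d)) has_real_derivative (\<Sum>i\<in>UNIV. gradient p (u + t *\<^sub>R d) $ i * d $ i)) (at t)"
    by (rule chain) (rule D(1))
  have "((\<lambda>t. \<Sum>i\<in>UNIV. gradient p (u + t *\<^sub>R d) $ i * d $ i) has_real_derivative
      (\<Sum>i\<in>UNIV. (\<Sum>j\<in>UNIV. hessian p (u + t *\<^sub>R d) $ i $ j * d $ j) * d $ i)) (at t)"
    by (intro DERIV_sum DERIV_cmult_right chain D(2))
  then show "((\<lambda>t. \<Sum>i\<in>UNIV. gradient p (u + t *\<^sub>R d) $ i * d $ i) has_real_derivative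
      (\<Sum>i\<in>UNIV. \<Sum>j\<in>UNIV. hessian p (u + t *\<^sub>R d) $ i $ j * d $ i * d $ j)) (at t)"
    by (simp add: sum_distrib_left mult_ac)
qed

text \<open>The identity d^T (h h^T) d = |h^T d|^2 in coordinates.\<close>

lemma gram_quadratic_form:
  fixes h :: "'n::finite \<Rightarrow> nat \<Rightarrow> real"
  shows "(\<Sum>a\<in>UNIV. \<Sum>b\<in>UNIV. (\<Sum>j<s. h a j * h b j) * d a * d b) = (\<Sum>j<s. (\<Sum>a\<in>UNIV. d a * h a j)\<^sup>2)"
proof -
  have "(\<Sum>j<s. (\<Sum>a\<in>UNIV. d a * h a j)\<^sup>2) = (\<Sum>j<s. \<Sum>a\<in>UNIV. \<Sum>b\<in>UNIV. h a j * h b j * d a * d b)"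
    unfolding power2_eq_square sum_product by (intro sum.cong refl) (simp add: mult_ac)
  also have "\<dots> = (\<Sum>a\<in>UNIV. \<Sum>j<s. \<Sum>b\<in>UNIV. h a j * h b j * d a * d b)"
    by (rule sum.swap)
  also have "\<dots> = (\<Sum>a\<in>UNIV. \<Sum>b\<in>UNIV. \<Sum>j<s. h a j * h b j * d a * d b)"
    by (intro sum.cong refl sum.swap)
  finally show ?thesis
    by (simp add: sum_distrib_right)
qed

lemma sos_convex_imp_convex_on:
  fixes p :: "real ^ 'n \<Rightarrow> real"
  assumes "sos_convex p"
  shows "convex_on UNIV p"
proof -
  obtain s :: nat and H where p: "real_polynomial_function p"
    and H: "\<And>x a b. hessian p x $ a $ b = (\<Sum>j<s. H a j x * H b j x)"
    using assms unfolding sos_convex_def by blast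
  have "p (v *\<^sub>R x + w *\<^sub>R y) \<le> v * p x + w * p y" if vw: "0 \<le> v" "0 \<le> w" "v + w = 1" for x y v w
  proof -
    have "convex_on UNIV (\<lambda>t. p (x + t *\<^sub>R (y - x)))"
    proof (rule f''_ge0_imp_convex[OF _ DERIV_along_line[OF p]])
      fix t :: real
      show "0 \<le> (\<Sum>i\<in>UNIV. \<Sum>j\<in>UNIV. hessian p (x + t *\<^sub>R (y - x)) $ i $ j * (y - x) $ i * (y - x) $ j)"
        unfolding H gram_quadratic_form by (intro sum_nonneg zero_le_power2)
    qed simp
    then have "p (x + (v *\<^sub>R 0 + w *\<^sub>R 1) *\<^sub>R (y - x)) \<le> v * p (x + 0 *\<^sub>R (y - x)) + w * p (x + 1 *\<^sub>R (y - x))"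
      using vw unfolding convex_on_def by blast
    moreover have "x + w *\<^sub>R (y - x) = v *\<^sub>R x + w *\<^sub>R y"
      using vw by (simp add: algebra_simps flip: scaleR_add_left[of v w x])
    ultimately show ?thesis
      by simp
  qed
  then show ?thesis
    by (simp add: convex_on_def)
qed

lemma sum_of_squares_sum:
  assumes "finite I" "\<And>i. i \<in> I \<Longrightarrow> real_polynomial_function (q i)"
  shows "sum_of_squares (\<lambda>x. \<Sum>i\<in>I. (q i x)\<^sup>2)"
proof -
  obtain h where h: "bij_betw h {..<card I} I"
    using ex_bij_betw_nat_finite[OF assms(1)] by (auto simp: atLeast0LessThan)
  have "(\<Sum>i\<in>I. (q i x)\<^sup>2) = (\<Sum>j<card I. (q (h j) x)\<^sup>2)" for x
    using sum.reindex_bij_betw[OF h, of "\<lambda>i. (q i x)\<^sup>2"] by simp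
  then show ?thesis
    unfolding sum_of_squares_def using assms(2) bij_betwE[OF h]
    by (intro exI[of _ "card I"] exI[of _ "\<lambda>j. q (h j)"]) auto
qed

lemma sum_of_squares_add_const:
  assumes "sum_of_squares p" "0 \<le> c"
  shows "sum_of_squares (\<lambda>x. p x + c)"
proof -
  obtain N :: nat and q where q: "\<And>j. j < N \<Longrightarrow> real_polynomial_function (q j)" "\<And>x. p x = (\<Sum>j<N. (q j x)\<^sup>2)"
    using assms(1) unfolding sum_of_squares_def by blast
  define q' where "q' = (\<lambda>j. if j < N then q j else (\<lambda>_. sqrt c))"
  have "p x + c = (\<Sum>j<Suc N. (q' j x)\<^sup>2)" for x
    using assms(2) by (simp add: q(2) q'_def)
  moreover have "real_polynomial_function (q' j)" for j
    using q(1) by (cases "j < N") (auto simp: q'_def intro: real_polynomial_function.intros)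
  ultimately show ?thesis
    unfolding sum_of_squares_def by (intro exI[of _ "Suc N"] exI[of _ q']) simp
qed

text \<open>Taylor's formula \<open>p x = \<integral>\<^sub>0\<^sup>1 (1 - t) \<phi>'' t dt\<close> with \<open>\<phi> t = p (u + t (x - u))\<close>; integrating out
  the powers of \<open>t\<close> leaves quadratic forms with the matrix \<open>1 / ((k + l + 1) (k + l + 2))\<close>.\<close>

lemma sos_convex_imp_sum_of_squares_critical:
  fixes p :: "real ^ 'n \<Rightarrow> real"
  assumes "sos_convex p" "p u = 0" "gradient p u = 0"
  shows "sum_of_squares p"
proof -
  obtain s :: nat and H where p: "real_polynomial_function p"
    and H_poly: "\<And>a j. j < s \<Longrightarrow> real_polynomial_function (H a j)"
    and H: "\<And>x a b. hessian p x $ a $ b = (\<Sum>j<s. H a j x * H b j x)"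
    using assms(1) unfolding sos_convex_def by blast
  \<comment> \<open>\<open>e k\<close> is the coefficient of \<open>t ^ k\<close> in entry
    \<open>j\<close> of H^T (x - u) along the segment from \<open>u\<close> to \<open>x\<close>.
    Naming the property lets length and coefficients be chosen together for each column
    \<open>j\<close>.\<close>
  define P where "P = (\<lambda>j M e. (\<forall>k. real_polynomial_function (e k)) \<and>
      (\<forall>x t. (\<Sum>a\<in>UNIV. (x - u) $ a * H a j (u + t *\<^sub>R (x - u))) = (\<Sum>k<M::nat. e k x * t ^ k)))"
  have "\<exists>M e. P j M e" if "j < s" for j
  proof -
    have "\<forall>a. \<exists>N c. (\<forall>k. real_polynomial_function (c k)) \<and>
      (\<forall>x t. H a j (u + t *\<^sub>R (x - u)) = (\<Sum>k<N::nat. c k x * t ^ k))"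
      using real_polynomial_function_along_line[OF H_poly[OF that]] by blast
    then obtain N c where c: "\<And>a k. real_polynomial_function (c a k)"
        "\<And>a x t. H a j (u + t *\<^sub>R (x - u)) = (\<Sum>k<N a::nat. c a k x * t ^ k)"
      by metis
    \<comment> \<open>The entries of a column may have expansions of different lengths; the maximum
      over the finitely many coordinates serves all of them, with zero padding.\<close>
    define M where "M = Max (range N)"
    have NM: "N a \<le> M" for a
      unfolding M_def by (intro Max_ge) auto
    define e where "e = (\<lambda>k x. \<Sum>a\<in>UNIV. (x $ a - u $ a) * (if k < N a then c a k x else 0))"
    have "real_polynomial_function (\<lambda>x. if k < N a then c a k x else 0)" for a k
      using c(1) by (cases "k < N a") (auto intro: real_polynomial_function.intros)
    moreover have "real_polynomial_function (\<lambda>x. x $ a - u $ a)" for a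
      by (rule real_polynomial_function_diff)
         (auto intro: real_polynomial_function.intros bounded_linear_vec_nth)
    ultimately have "real_polynomial_function (e k)" for k
      unfolding e_def by (intro real_polynomial_function_sum real_polynomial_function.intros(4)) auto
    moreover have "(\<Sum>a\<in>UNIV. (x - u) $ a * H a j (u + t *\<^sub>R (x - u))) = (\<Sum>k<M. e k x * t ^ k)" for x t
    proof -
      have "H a j (u + t *\<^sub>R (x - u)) = (\<Sum>k<M. (if k < N a then c a k x else 0) * t ^ k)" for a
        unfolding c(2) using NM[of a] by (intro sum.mono_neutral_cong_left) auto
      then have "(\<Sum>a\<in>UNIV. (x - u) $ a * H a j (u + t *\<^sub>R (x - u)))
          = (\<Sum>a\<in>UNIV. \<Sum>k<M. (x $ a - u $ a) * (if k < N a then c a k x else 0) * t ^ k)"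
        by (simp only: sum_distrib_left mult.assoc vector_minus_component)
      also have "\<dots> = (\<Sum>k<M. \<Sum>a\<in>UNIV. (x $ a - u $ a) * (if k < N a then c a k x else 0) * t ^ k)"
        by (rule sum.swap)
      finally show ?thesis
        by (simp only: e_def sum_distrib_right)
    qed
    ultimately show ?thesis
      unfolding P_def by (intro exI[of _ M] exI[of _ e] conjI allI)
  qed
  then obtain N c where P: "\<And>j. j < s \<Longrightarrow> P j (N j) (c j)"
    by metis
  then have c_poly: "\<And>j k. j < s \<Longrightarrow> real_polynomial_function (c j k)"
    and c: "\<And>j x t. j < s \<Longrightarrow>
      (\<Sum>a\<in>UNIV. (x - u) $ a * H a j (u + t *\<^sub>R (x - u))) = (\<Sum>k<N j. c j k x * t ^ k)"
    by (auto simp: P_def)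
  have "\<forall>j. \<exists>L :: nat \<Rightarrow> nat \<Rightarrow> real. \<forall>k<N j. \<forall>l<N j.
      1 / ((real (k + l) + 1) * (real (k + l) + 2)) = (\<Sum>m<N j. L m k * L m l)"
    by (intro allI double_primitive_gram)
  from choice[OF this]
  obtain L :: "nat \<Rightarrow> nat \<Rightarrow> nat \<Rightarrow> real" where L: "\<And>j k l. k < N j \<Longrightarrow> l < N j \<Longrightarrow>
      1 / ((real (k + l) + 1) * (real (k + l) + 2)) = (\<Sum>m<N j. L j m k * L j m l)"
    by blast
  define I where "I = Sigma {..<s} (\<lambda>j. {..<N j})"
  \<comment> \<open>Entry \<open>m\<close> of the Gram factor \<open>L j\<close> applied to the
    coefficient vector of column \<open>j\<close>; hence one square for each pair in
    \<open>I\<close>.\<close>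
  define q where "q = (\<lambda>(j, m) x. \<Sum>k<N j. L j m k * c j k x)"
  have "p x = (\<Sum>i\<in>I. (q i x)\<^sup>2)" for x
  proof -
    let ?d = "x - u"
    let ?\<psi> = "\<lambda>j t. \<Sum>k<N j. \<Sum>l<N j. c j k x * c j l x / ((real (k + l) + 1) * (real (k + l) + 2)) * t ^ (k + l + 2)"
    let ?\<psi>' = "\<lambda>j t. \<Sum>k<N j. \<Sum>l<N j. c j k x * c j l x / (real (k + l) + 1) * t ^ (k + l + 1)"
    have "(\<Sum>i\<in>UNIV. \<Sum>j\<in>UNIV. hessian p (u + t *\<^sub>R ?d) $ i $ j * ?d $ i * ?d $ j)
        = (\<Sum>j<s. (\<Sum>k<N j. c j k x * t ^ k)\<^sup>2)" for t
      unfolding H gram_quadratic_form using c by (intro sum.cong) auto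
    then have \<phi>'': "((\<lambda>t. \<Sum>i\<in>UNIV. gradient p (u + t *\<^sub>R ?d) $ i * ?d $ i) has_real_derivative
        (\<Sum>j<s. (\<Sum>k<N j. c j k x * t ^ k)\<^sup>2)) (at t)" for t
      using DERIV_along_line(2)[OF p, of u ?d t] by (simp only:)
    have \<psi>: "((\<lambda>t. \<Sum>j<s. ?\<psi> j t) has_real_derivative (\<Sum>j<s. ?\<psi>' j t)) (at t)" for t
      by (intro DERIV_sum DERIV_double_primitive_square(1))
    have \<psi>': "((\<lambda>t. \<Sum>j<s. ?\<psi>' j t) has_real_derivative (\<Sum>j<s. (\<Sum>k<N j. c j k x * t ^ k)\<^sup>2)) (at t)" for t
      by (intro DERIV_sum DERIV_double_primitive_square(2))
    \<comment> \<open>At t = 0 both sides vanish together with their first derivatives, by the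
      assumptions at \<open>u\<close> and the positive powers of t in the primitives; at t = 1 the
      line has reached \<open>x\<close>.\<close>
    have "p (u + 1 *\<^sub>R ?d) = (\<Sum>j<s. ?\<psi> j 1)"
      by (rule eq_at_1_of_deriv2[OF DERIV_along_line(1)[OF p] \<phi>'' \<psi> \<psi>'])
         (simp_all add: assms(2,3))
    also have "(\<Sum>j<s. ?\<psi> j 1) = (\<Sum>j<s. \<Sum>m<N j. (q (j, m) x)\<^sup>2)"
    proof (rule sum.cong)
      fix j
      have "(\<Sum>m<N j. (q (j, m) x)\<^sup>2)
          = (\<Sum>m<N j. \<Sum>k<N j. \<Sum>l<N j. L j m k * L j m l * (c j k x * c j l x))"
        unfolding q_def power2_eq_square split sum_product by (intro sum.cong refl) (simp add: mult_ac)
      also have "\<dots> = (\<Sum>k<N j. \<Sum>m<N j. \<Sum>l<N j. L j m k * L j m l * (c j k x * c j l x))"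
        by (rule sum.swap)
      also have "\<dots> = (\<Sum>k<N j. \<Sum>l<N j. \<Sum>m<N j. L j m k * L j m l * (c j k x * c j l x))"
        by (intro sum.cong refl sum.swap)
      also have "\<dots> = ?\<psi> j 1"
        unfolding sum_distrib_right[symmetric] by (intro sum.cong refl) (simp flip: L)
      finally show "?\<psi> j 1 = (\<Sum>m<N j. (q (j, m) x)\<^sup>2)" ..
    qed simp
    also have "\<dots> = (\<Sum>i\<in>I. (q i x)\<^sup>2)"
      unfolding I_def by (subst sum.Sigma) (auto simp: split_beta)
    finally show ?thesis
      by simp
  qed
  moreover have "real_polynomial_function (q i)" if "i \<in> I" for i
    using that c_poly unfolding q_def I_def
    by (auto intro!: real_polynomial_function_sum real_polynomial_function.intros(4) real_polynomial_function.intros(2))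
  moreover have "finite I"
    by (simp add: I_def)
  ultimately show ?thesis
    using sum_of_squares_sum[of I q] by presburger
qed

lemma sos_convex_nonneg_imp_sum_of_squares:
  fixes p :: "real ^ 'n \<Rightarrow> real"
  assumes "sos_convex p" and nonneg: "\<And>x. 0 \<le> p x"
  shows "sum_of_squares p"
proof -
  have p: "real_polynomial_function p"
    using assms(1) by (simp add: sos_convex_def)
  obtain u where u: "\<And>x. p u \<le> p x"
    using convex_polynomial_attains_min[OF p sos_convex_imp_convex_on[OF assms(1)] nonneg] by auto
  \<comment> \<open>Subtracting the minimum gives a zero that is also a critical point. The constant
    \<open>p u\<close> is restored at the end, as the square of its root.\<close>
  define q where "q = (\<lambda>x. p x + (- p u))"
  have q: "sos_convex q"
    unfolding q_def by (intro sos_convex_add assms(1) sos_convex_const)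
  then have q_poly: "real_polynomial_function q"
    by (simp add: sos_convex_def)
  have "frechet_derivative q (at u) = (\<lambda>h. 0)"
  proof (rule differential_zero_maxmin)
    show "(q has_derivative frechet_derivative q (at u)) (at u)"
      unfolding frechet_derivative_works[symmetric]
      by (rule differentiableI) (rule real_polynomial_function_derivatives(1)[OF q_poly])
    show "(\<forall>y\<in>UNIV. q y \<le> q u) \<or> (\<forall>y\<in>UNIV. q u \<le> q y)"
      using u by (simp add: q_def)
  qed auto
  then have "gradient q u = 0"
    by (simp add: gradient_def vec_eq_iff)
  then have "sum_of_squares q"
    using sos_convex_imp_sum_of_squares_critical[OF q, of u] by (simp add: q_def)
  then have "sum_of_squares (\<lambda>x. q x + p u)"
    using nonneg by (rule sum_of_squares_add_const)
  then show ?thesis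
    by (simp add: q_def)
qed

section \<open>Total degree\<close>

text \<open>The property whose least \<open>d\<close> is \<open>total_degree\<close>. Upper bounds
  pass through sums and products directly, which a \<open>LEAST\<close> does not.\<close>

definition degree_le :: "nat \<Rightarrow> (real ^ 'n \<Rightarrow> real) \<Rightarrow> bool"
  where "degree_le d p \<longleftrightarrow> (\<exists>c :: ('n \<Rightarrow> nat) \<Rightarrow> real. \<forall>x.
    p x = (\<Sum>\<alpha> | (\<Sum>i\<in>UNIV. \<alpha> i) \<le> d. c \<alpha> * (\<Prod>i\<in>UNIV. (x $ i) ^ \<alpha> i)))"

lemma finite_multi_indices: "finite {\<alpha> :: 'n::finite \<Rightarrow> nat. (\<Sum>i\<in>UNIV. \<alpha> i) \<le> d}"
proof (rule finite_subset)
  show "{\<alpha> :: 'n \<Rightarrow> nat. (\<Sum>i\<in>UNIV. \<alpha> i) \<le> d} \<subseteq> Pi\<^sub>E UNIV (\<lambda>_. {..d})"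
  proof
    fix \<alpha> :: "'n \<Rightarrow> nat" assume "\<alpha> \<in> {\<alpha>. (\<Sum>i\<in>UNIV. \<alpha> i) \<le> d}"
    moreover have "\<alpha> i \<le> (\<Sum>i\<in>UNIV. \<alpha> i)" for i
      by (rule member_le_sum) auto
    ultimately show "\<alpha> \<in> Pi\<^sub>E UNIV (\<lambda>_. {..d})"
      using order_trans by fastforce
  qed
qed (simp add: finite_PiE)

lemma degree_le_mono:
  assumes "degree_le d p" "d \<le> e"
  shows "degree_le e p"
proof -
  obtain c where c: "\<And>x. p x = (\<Sum>\<alpha> | (\<Sum>i\<in>UNIV. \<alpha> i) \<le> d. c \<alpha> * (\<Prod>i\<in>UNIV. (x $ i) ^ \<alpha> i))"
    using assms(1) unfolding degree_le_def by blast
  have "p x = (\<Sum>\<alpha> | (\<Sum>i\<in>UNIV. \<alpha> i) \<le> e.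
      (if (\<Sum>i\<in>UNIV. \<alpha> i) \<le> d then c \<alpha> else 0) * (\<Prod>i\<in>UNIV. (x $ i) ^ \<alpha> i))" for x
    unfolding c using assms(2) by (intro sum.mono_neutral_cong_left finite_multi_indices) auto
  then show ?thesis
    unfolding degree_le_def
    by (intro exI[of _ "\<lambda>\<alpha>. if (\<Sum>i\<in>UNIV. \<alpha> i) \<le> d then c \<alpha> else 0"] allI)
qed

lemma degree_le_monomial:
  fixes \<alpha> :: "'n::finite \<Rightarrow> nat"
  assumes "(\<Sum>i\<in>UNIV. \<alpha> i) \<le> d"
  shows "degree_le d (\<lambda>x. a * (\<Prod>i\<in>UNIV. (x $ i) ^ \<alpha> i))"
proof -
  have "(\<Sum>\<beta> | (\<Sum>i\<in>UNIV. \<beta> i) \<le> d. (if \<beta> = \<alpha> then a else 0) * (\<Prod>i\<in>UNIV. (x $ i) ^ \<beta> i))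
      = (\<Sum>\<beta>\<in>{\<alpha>}. a * (\<Prod>i\<in>UNIV. (x $ i) ^ \<beta> i))" for x :: "real ^ 'n"
    using assms by (intro sum.mono_neutral_cong_right finite_multi_indices) auto
  then show ?thesis
    unfolding degree_le_def by (intro exI[of _ "\<lambda>\<beta>. if \<beta> = \<alpha> then a else 0"] allI) simp
qed

lemma degree_le_const: "degree_le d (\<lambda>x. a)"
  using degree_le_monomial[of "\<lambda>_. 0" d a] by simp

lemma degree_le_add:
  assumes "degree_le d p" "degree_le d q"
  shows "degree_le d (\<lambda>x. p x + q x)"
proof -
  obtain c where c: "\<And>x. p x = (\<Sum>\<alpha> | (\<Sum>i\<in>UNIV. \<alpha> i) \<le> d. c \<alpha> * (\<Prod>i\<in>UNIV. (x $ i) ^ \<alpha> i))"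
    using assms(1) unfolding degree_le_def by blast
  obtain b where b: "\<And>x. q x = (\<Sum>\<alpha> | (\<Sum>i\<in>UNIV. \<alpha> i) \<le> d. b \<alpha> * (\<Prod>i\<in>UNIV. (x $ i) ^ \<alpha> i))"
    using assms(2) unfolding degree_le_def by blast
  show ?thesis
    unfolding degree_le_def c b
    by (intro exI[of _ "\<lambda>\<alpha>. c \<alpha> + b \<alpha>"] allI) (simp only: distrib_right sum.distrib)
qed

lemma degree_le_sum:
  assumes "finite I" "\<And>i. i \<in> I \<Longrightarrow> degree_le d (p i)"
  shows "degree_le d (\<lambda>x. \<Sum>i\<in>I. p i x)"
  using assms by (induction I rule: finite_induct) (simp_all add: degree_le_add degree_le_const)

lemma degree_le_mult:
  assumes "degree_le d p" "degree_le e q"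
  shows "degree_le (d + e) (\<lambda>x. p x * q x)"
proof -
  obtain c where c: "\<And>x. p x = (\<Sum>\<alpha> | (\<Sum>i\<in>UNIV. \<alpha> i) \<le> d. c \<alpha> * (\<Prod>i\<in>UNIV. (x $ i) ^ \<alpha> i))"
    using assms(1) unfolding degree_le_def by blast
  obtain b where b: "\<And>x. q x = (\<Sum>\<alpha> | (\<Sum>i\<in>UNIV. \<alpha> i) \<le> e. b \<alpha> * (\<Prod>i\<in>UNIV. (x $ i) ^ \<alpha> i))"
    using assms(2) unfolding degree_le_def by blast
  have "p x * q x = (\<Sum>\<alpha> | (\<Sum>i\<in>UNIV. \<alpha> i) \<le> d. \<Sum>\<beta> | (\<Sum>i\<in>UNIV. \<beta> i) \<le> e.
      c \<alpha> * b \<beta> * (\<Prod>i\<in>UNIV. (x $ i) ^ (\<alpha> i + \<beta> i)))" for x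
    unfolding c b sum_product by (intro sum.cong refl) (simp add: power_add prod.distrib)
  moreover have "degree_le (d + e) (\<lambda>x. \<Sum>\<alpha> | (\<Sum>i\<in>UNIV. \<alpha> i) \<le> d. \<Sum>\<beta> | (\<Sum>i\<in>UNIV. \<beta> i) \<le> e.
      c \<alpha> * b \<beta> * (\<Prod>i\<in>UNIV. (x $ i) ^ (\<alpha> i + \<beta> i)))"
    by (intro degree_le_sum finite_multi_indices degree_le_monomial) (simp add: sum.distrib add_mono)
  ultimately show ?thesis
    by (simp only:)
qed

lemma degree_le_cmult: "degree_le d p \<Longrightarrow> degree_le d (\<lambda>x. a * p x)"
  using degree_le_mult[OF degree_le_const[of 0 a]] by simp

lemma real_polynomial_function_imp_degree_le:
  fixes p :: "real ^ 'n \<Rightarrow> real"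
  assumes "real_polynomial_function p"
  shows "\<exists>d. degree_le d p"
  using assms
proof induction
  case (linear f)
  have "f x = (\<Sum>k\<in>UNIV. f (axis k 1) * (\<Prod>i\<in>UNIV. (x $ i) ^ (if i = k then 1 else 0)))" for x
  proof -
    have "(\<Prod>i\<in>UNIV. (x $ i) ^ (if i = k then 1 else 0)) = x $ k" for k
      by (simp add: if_distrib cong: if_cong)
    moreover have "f x = f (\<Sum>k\<in>UNIV. x $ k *\<^sub>R axis k 1)"
      using basis_expansion[of x] by (simp add: scalar_mult_eq_scaleR)
    then have "f x = (\<Sum>k\<in>UNIV. f (axis k 1) * x $ k)"
      using bounded_linear.linear[OF linear] by (simp add: linear_sum linear_cmul mult.commute)
    ultimately show ?thesis
      by (simp only:)
  qed
  then have "(\<lambda>x. \<Sum>k\<in>UNIV. f (axis k 1) * (\<Prod>i\<in>UNIV. (x $ i) ^ (if i = k then 1 else 0))) = f"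
    by (intro ext) (rule sym)
  moreover have "degree_le 1 (\<lambda>x :: real ^ 'n. \<Sum>k\<in>UNIV. f (axis k 1) * (\<Prod>i\<in>UNIV. (x $ i) ^ (if i = k then 1 else 0)))"
    by (intro degree_le_sum degree_le_monomial) auto
  ultimately have "degree_le 1 f"
    by (rule back_subst[of "degree_le 1", rotated])
  then show ?case ..
next
  case (const c)
  show ?case by (intro exI[of _ 0] degree_le_const)
next
  case (add f g)
  then obtain d e where "degree_le d f" "degree_le e g" by blast
  then have "degree_le (max d e) f" "degree_le (max d e) g"
    by (auto intro: degree_le_mono)
  then show ?case by (intro exI[of _ "max d e"] degree_le_add)
next
  case (mult f g)
  then obtain d e where "degree_le d f" "degree_le e g" by blast
  then show ?case by (intro exI[of _ "d + e"] degree_le_mult)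
qed

lemma total_degree_le: "degree_le d p \<Longrightarrow> total_degree p \<le> d"
  unfolding total_degree_def degree_le_def by (rule Least_le)

lemma degree_le_total_degree:
  assumes "real_polynomial_function p"
  shows "degree_le (total_degree p) p"
  using real_polynomial_function_imp_degree_le[OF assms] unfolding total_degree_def degree_le_def
  by (rule LeastI_ex)

section \<open>Strong duality\<close>

lemma total_degree_le_RD_degree:
  assumes "i \<le> k" "j \<in> {1..s i}"
  shows "total_degree (\<lambda>x. f i x (v i j)) \<le> RD_degree k f s v"
proof -
  let ?D = "\<lambda>i. Max {total_degree (\<lambda>x. f i x (v i j)) | j. j \<in> {1..s i}}"
  define M where "M = max (?D 0) (Max {?D i | i. i \<in> {1..k}})"
  \<comment> \<open>An even bound, so the \<open>LEAST\<close> in \<open>RD_degree\<close> has a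
    witness.\<close>
  have "even (2 * M) \<and> M \<le> 2 * M"
    by simp
  then have "M \<le> RD_degree k f s v"
    unfolding RD_degree_def M_def by (rule LeastI2) simp
  moreover have "total_degree (\<lambda>x. f i x (v i j)) \<le> ?D i"
    using assms(2) by (intro Max_ge) auto
  moreover have "?D i \<le> M"
  proof (cases "i = 0")
    case False
    then have "?D i \<le> Max {?D i | i. i \<in> {1..k}}"
      using assms(1) by (intro Max_ge) auto
    then show ?thesis by (simp add: M_def)
  qed (simp add: M_def)
  ultimately show ?thesis
    by linarith
qed

lemma convex_topspace_Euclidean_space: "convex (topspace (Euclidean_space m))"
  by (auto simp: convex_def topspace_Euclidean_space scaleR_fun_def)

text \<open>The sublevel set of \<open>g\<close> inside \<open>E\<close> is convex and contains
  \<open>S\<close>, hence also its hull. Intersecting with \<open>E\<close> matters because affinity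
  is known only there.\<close>

lemma affine_map_on_convex_hull_le:
  assumes "affine_map_on E g" "convex E" "S \<subseteq> E" "\<And>w. w \<in> S \<Longrightarrow> g w \<le> c" "w \<in> convex hull S"
  shows "g w \<le> c"
proof -
  have "convex {w \<in> E. g w \<le> c}"
  proof (rule convexI)
    fix x y and a b :: real
    assume xy: "x \<in> {w \<in> E. g w \<le> c}" "y \<in> {w \<in> E. g w \<le> c}" and ab: "0 \<le> a" "0 \<le> b" "a + b = 1"
    have "g (a *\<^sub>R x + b *\<^sub>R y) = a * g x + b * g y"
      using assms(1) xy ab unfolding affine_map_on_def by blast
    also have "\<dots> \<le> c"
      using xy ab by (intro convex_bound_le) auto
    finally show "a *\<^sub>R x + b *\<^sub>R y \<in> {w \<in> E. g w \<le> c}"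
      using assms(2) xy ab by (auto simp: convex_def)
  qed
  then have "convex hull S \<subseteq> {w \<in> E. g w \<le> c}"
    using assms(3,4) by (intro hull_minimal) auto
  then show ?thesis
    using assms(5) by auto
qed

theorem theorem4p2:
  fixes k :: nat
    and s m :: "nat \<Rightarrow> nat"
    and v :: "nat \<Rightarrow> nat \<Rightarrow> nat \<Rightarrow> real"
    and V :: "nat \<Rightarrow> (nat \<Rightarrow> real) set"
    and f :: "nat \<Rightarrow> real ^ 'n \<Rightarrow> (nat \<Rightarrow> real) \<Rightarrow> real"
  assumes "1 \<le> k"
    and "\<And>i. i \<le> k \<Longrightarrow> 1 \<le> s i"
    and "\<And>i j. i \<le> k \<Longrightarrow> j \<in> {1..s i} \<Longrightarrow> v i j \<in> topspace (Euclidean_space (m i))"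
    and "\<And>i. i \<le> k \<Longrightarrow> V i = convex hull (v i ` {1..s i})"
    and "\<And>i w. i \<le> k \<Longrightarrow> w \<in> V i \<Longrightarrow> sos_convex (\<lambda>x. f i x w)"
    and "\<And>i x. i \<le> k \<Longrightarrow> affine_map_on (topspace (Euclidean_space (m i))) (f i x)"
    and "\<exists>xbar. \<forall>i\<in>{1..k}. \<forall>j\<in>{1..s i}. f i xbar (v i j) < 0"
  shows "inf_RP k f V = sup_RD k f s v \<and>
    (inf_RP k f V \<noteq> -\<infinity> \<longrightarrow> (\<exists>\<mu>\<in>RD_values k f s v. inf_RP k f V = ereal \<mu>))"
proof -
  have vV: "v i j \<in> V i" if "i \<le> k" "j \<in> {1..s i}" for i j
    using assms(4)[OF that(1)] that(2) by (simp add: hull_inc)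
  \<comment> \<open>Reduces the uncertainty to the vertices: with \<open>c = 0\<close> for the
    constraints, with the largest vertex value for the objective.\<close>
  have V_le: "f i x w \<le> c" if "i \<le> k" "w \<in> V i" "\<And>j. j \<in> {1..s i} \<Longrightarrow> f i x (v i j) \<le> c" for i x w c
  proof (rule affine_map_on_convex_hull_le[where g="f i x" and E="topspace (Euclidean_space (m i))" and S="v i ` {1..s i}"])
    show "affine_map_on (topspace (Euclidean_space (m i))) (f i x)"
      using assms(6) that(1) .
    show "w \<in> convex hull (v i ` {1..s i})"
      using assms(4) that(1,2) by simp
  qed (use assms(3) that convex_topspace_Euclidean_space in auto)
  have feasible_iff: "x \<in> robust_feasible k f V \<longleftrightarrow> (\<forall>i\<in>{1..k}. \<forall>j\<in>{1..s i}. f i x (v i j) \<le> 0)" for x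
    using vV V_le[where c=0] by (auto simp: robust_feasible_def)
  define F where "F = (\<lambda>x. SUP w\<in>V 0. ereal (f 0 x w))"
  have F_ge: "ereal (f 0 x (v 0 l)) \<le> F x" if "l \<in> {1..s 0}" for x l
    unfolding F_def using vV[of 0 l] that by (intro SUP_upper) auto
  have F_attained: "\<exists>l\<in>{1..s 0}. F x = ereal (f 0 x (v 0 l)) \<and> (\<forall>j\<in>{1..s 0}. f 0 x (v 0 j) \<le> f 0 x (v 0 l))" for x
  proof -
    define M where "M = Max ((\<lambda>l. f 0 x (v 0 l)) ` {1..s 0})"
    have "M \<in> (\<lambda>l. f 0 x (v 0 l)) ` {1..s 0}"
      unfolding M_def using assms(2)[of 0] by (intro Max_in) auto
    then obtain l where l: "l \<in> {1..s 0}" "M = f 0 x (v 0 l)"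
      by auto
    have le: "f 0 x (v 0 j) \<le> f 0 x (v 0 l)" if "j \<in> {1..s 0}" for j
      unfolding l(2)[symmetric] M_def using that by (intro Max_ge) auto
    have "F x \<le> ereal (f 0 x (v 0 l))"
      unfolding F_def using V_le[of 0] le by (intro SUP_least) simp
    with F_ge[OF l(1), of x] have "F x = ereal (f 0 x (v 0 l))"
      by simp
    then show ?thesis
      using l(1) le by blast
  qed
  have inf_RP: "inf_RP k f V = (INF x\<in>robust_feasible k f V. F x)"
    by (simp add: inf_RP_def F_def)

  \<comment> \<open>Weak duality: a sum of squares is nonnegative, the constraint part is at most 0
    at a feasible point, and an average of vertex values is at most the largest one.\<close>
  have "ereal \<mu> \<le> F x" if \<mu>: "\<mu> \<in> RD_values k f s v" and x: "x \<in> robust_feasible k f V" for \<mu> x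
  proof -
    obtain \<delta> lam where \<delta>: "\<And>l. l \<in> {1..s 0} \<Longrightarrow> 0 \<le> \<delta> l" "(\<Sum>l=1..s 0. \<delta> l) = 1"
      and lam: "\<And>i j. i \<in> {1..k} \<Longrightarrow> j \<in> {1..s i} \<Longrightarrow> 0 \<le> lam i j"
      and sos: "sum_of_squares (\<lambda>x. (\<Sum>l=1..s 0. \<delta> l * f 0 x (v 0 l)) +
        (\<Sum>i=1..k. \<Sum>j=1..s i. lam i j * f i x (v i j)) - \<mu>)"
      using \<mu> unfolding RD_values_def Sigma2_def by blast
    obtain l where l: "F x = ereal (f 0 x (v 0 l))" "\<And>j. j \<in> {1..s 0} \<Longrightarrow> f 0 x (v 0 j) \<le> f 0 x (v 0 l)"
      using F_attained[of x] by blast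
    have "0 \<le> (\<Sum>l=1..s 0. \<delta> l * f 0 x (v 0 l)) + (\<Sum>i=1..k. \<Sum>j=1..s i. lam i j * f i x (v i j)) - \<mu>"
      using sos unfolding sum_of_squares_def by (metis (no_types, lifting) sum_nonneg zero_le_power2)
    moreover have "(\<Sum>i=1..k. \<Sum>j=1..s i. lam i j * f i x (v i j)) \<le> 0"
      using lam x by (intro sum_nonpos mult_nonneg_nonpos) (auto simp: feasible_iff)
    moreover have "(\<Sum>j=1..s 0. \<delta> j * f 0 x (v 0 j)) \<le> (\<Sum>j=1..s 0. \<delta> j * f 0 x (v 0 l))"
      using \<delta>(1) l(2) by (intro sum_mono mult_left_mono) auto
    moreover have "(\<Sum>j=1..s 0. \<delta> j * f 0 x (v 0 l)) = f 0 x (v 0 l)"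
      unfolding sum_distrib_right[symmetric] \<delta>(2) by simp
    ultimately show ?thesis
      by (simp add: l(1))
  qed
  then have weak: "sup_RD k f s v \<le> inf_RP k f V"
    unfolding sup_RD_def inf_RP by (intro SUP_least INF_greatest)

  have "\<exists>\<mu>\<in>RD_values k f s v. inf_RP k f V = ereal \<mu>" if fin: "inf_RP k f V \<noteq> -\<infinity>"
  proof -
    obtain xbar where xbar: "\<And>i j. i \<in> {1..k} \<Longrightarrow> j \<in> {1..s i} \<Longrightarrow> f i xbar (v i j) < 0"
      using assms(7) by blast
    then have "xbar \<in> robust_feasible k f V"
      unfolding feasible_iff by (meson less_imp_le)
    then have "inf_RP k f V \<le> F xbar"
      unfolding inf_RP by (rule INF_lower)
    moreover obtain l where "F xbar = ereal (f 0 xbar (v 0 l))"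
      using F_attained by blast
    \<comment> \<open>The Slater point is feasible with a finite objective, which excludes the value
      \<infinity>.\<close>
    ultimately obtain \<mu> where \<mu>: "inf_RP k f V = ereal \<mu>"
      using fin by (cases "inf_RP k f V") auto
    define I where "I = Sigma {..k} (\<lambda>i. {1..s i})"
    \<comment> \<open>Objective and constraints form a single family; the shift by \<mu> applies to
      index 0 only.\<close>
    define G where "G = (\<lambda>(i, j) x. f i x (v i j) + (if i = 0 then - \<mu> else 0))"
    have I: "finite I"
      by (simp add: I_def)
    have split_I: "sum h I = (\<Sum>l=1..s 0. h (0, l)) + (\<Sum>i=1..k. \<Sum>j=1..s i. h (i, j))" for h :: "nat \<times> nat \<Rightarrow> real"
    proof -
      have "sum h I = (\<Sum>i\<le>k. \<Sum>j=1..s i. h (i, j))"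
        unfolding I_def by (subst sum.Sigma) auto
      moreover have "{..k} = insert 0 {1..k}"
        by auto
      ultimately show ?thesis
        by simp
    qed
    have G_sos: "sos_convex (G ij)" if "ij \<in> I" for ij
      using that assms(5) vV unfolding G_def I_def
      by (auto intro!: sos_convex_add sos_convex_const)
    have G_degree: "degree_le (RD_degree k f s v) (G ij)" if mem: "ij \<in> I" for ij
    proof -
      obtain i j where ij: "ij = (i, j)" "i \<le> k" "j \<in> {1..s i}"
        using mem by (auto simp: I_def)
      have "real_polynomial_function (\<lambda>x. f i x (v i j))"
        using assms(5)[OF ij(2) vV[OF ij(2,3)]] by (simp add: sos_convex_def)
      then have "degree_le (RD_degree k f s v) (\<lambda>x. f i x (v i j))"
        using degree_le_mono[OF degree_le_total_degree total_degree_le_RD_degree[of i k j s f v, OF ij(2,3)]] by simp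
      then show ?thesis
        unfolding G_def ij(1) split by (intro degree_le_add degree_le_const)
    qed
    have "\<exists>ij\<in>I. 0 \<le> G ij x" for x
    proof (cases "\<forall>i\<in>{1..k}. \<forall>j\<in>{1..s i}. f i x (v i j) \<le> 0")
      case True
      then have "ereal \<mu> \<le> F x"
        unfolding \<mu>[symmetric] inf_RP by (intro INF_lower) (simp add: feasible_iff)
      moreover obtain l where "l \<in> {1..s 0}" "F x = ereal (f 0 x (v 0 l))"
        using F_attained by blast
      ultimately show ?thesis
        by (intro bexI[of _ "(0, l)"]) (auto simp: G_def I_def)
    next
      case False
      then obtain i j where "i \<in> {1..k}" "j \<in> {1..s i}" "0 < f i x (v i j)"
        by (auto simp: not_le)
      then show ?thesis
        by (intro bexI[of _ "(i, j)"]) (auto simp: G_def I_def)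
    qed
    moreover have "(0, 1) \<in> I"
      using assms(2)[of 0] by (simp add: I_def)
    ultimately obtain w where w: "\<And>ij. ij \<in> I \<Longrightarrow> 0 \<le> w ij" "sum w I = 1"
        "\<And>x. 0 \<le> (\<Sum>ij\<in>I. w ij * G ij x)"
      using gordan_convex[of I UNIV G] I G_sos sos_convex_imp_convex_on by blast
    define D where "D = (\<Sum>l=1..s 0. w (0, l))"
    have "0 \<le> D"
      unfolding D_def using w(1) by (intro sum_nonneg) (auto simp: I_def)
    moreover have "D \<noteq> 0"
    \<comment> \<open>Without objective weight, every term at the Slater point is at most 0 while
      their sum is nonnegative, so each term is 0. The strictly negative constraint values then
      force all weights to vanish, against their sum 1.\<close>
    proof
      assume "D = 0"
      then have w0: "w (0, l) = 0" if "l \<in> {1..s 0}" for l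
        unfolding D_def using w(1) that by (subst (asm) sum_nonneg_eq_0_iff) (auto simp: I_def)
      have alt: "w ij = 0 \<or> G ij xbar < 0" if "ij \<in> I" for ij
        using that w0 xbar by (cases "fst ij = 0") (auto simp: I_def G_def)
      have neg: "w ij * G ij xbar \<le> 0" if "ij \<in> I" for ij
        using alt[OF that] w(1)[OF that] by (auto simp: mult_le_0_iff)
      then have "(\<Sum>ij\<in>I. w ij * G ij xbar) = 0"
        using w(3)[of xbar] by (intro antisym sum_nonpos)
      then have "(\<Sum>ij\<in>I. - (w ij * G ij xbar)) = 0"
        by (simp add: sum_negf)
      then have zero: "w ij * G ij xbar = 0" if "ij \<in> I" for ij
        using that I neg by (subst (asm) sum_nonneg_eq_0_iff) auto
      have "w ij = 0" if "ij \<in> I" for ij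
        using alt[OF that] zero[OF that] by auto
      then show False
        using w(2) by simp
    qed
    ultimately have D: "0 < D"
      by simp
    \<comment> \<open>Division by \<open>D\<close> normalizes the objective weights to sum 1, so the
      shifts add up to exactly -\<mu>.\<close>
    define p where "p = (\<lambda>x. \<Sum>ij\<in>I. w ij / D * G ij x)"
    have p_eq: "p x = (\<Sum>l=1..s 0. w (0, l) / D * f 0 x (v 0 l)) +
        (\<Sum>i=1..k. \<Sum>j=1..s i. w (i, j) / D * f i x (v i j)) - \<mu>" for x
    proof -
      have "(\<Sum>l=1..s 0. w (0, l) / D * \<mu>) = \<mu>"
        unfolding sum_distrib_right[symmetric] sum_divide_distrib[symmetric] D_def[symmetric] using D by simp
      then have "(\<Sum>l=1..s 0. w (0, l) / D * G (0, l) x) = (\<Sum>l=1..s 0. w (0, l) / D * f 0 x (v 0 l)) - \<mu>"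
        by (simp add: G_def right_diff_distrib sum_subtractf)
      moreover have "(\<Sum>i=1..k. \<Sum>j=1..s i. w (i, j) / D * G (i, j) x) = (\<Sum>i=1..k. \<Sum>j=1..s i. w (i, j) / D * f i x (v i j))"
        by (intro sum.cong refl) (auto simp: G_def)
      ultimately show ?thesis
        unfolding p_def split_I by simp
    qed
    have "sos_convex p"
      unfolding p_def using I w(1) D G_sos by (intro sos_convex_sum sos_convex_cmult) auto
    moreover have "0 \<le> p x" for x
    proof -
      have "p x = (\<Sum>ij\<in>I. w ij * G ij x) / D"
        by (simp add: p_def sum_divide_distrib)
      then show ?thesis
        using w(3) D by simp
    qed
    ultimately have "sum_of_squares p"
      by (rule sos_convex_nonneg_imp_sum_of_squares)
    \<comment> \<open>\<open>Sigma2\<close> bounds the degree of \<open>p\<close> itself, so the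
      degrees of the squared polynomials need no estimate.\<close>
    moreover have "degree_le (RD_degree k f s v) p"
      unfolding p_def using I G_degree by (intro degree_le_sum degree_le_cmult)
    ultimately have "p \<in> Sigma2 (RD_degree k f s v)"
      by (simp add: Sigma2_def total_degree_le)
    moreover have "p = (\<lambda>x. (\<Sum>l=1..s 0. w (0, l) / D * f 0 x (v 0 l)) +
        (\<Sum>i=1..k. \<Sum>j=1..s i. w (i, j) / D * f i x (v i j)) - \<mu>)"
      using p_eq by (rule ext)
    moreover have "(\<Sum>l=1..s 0. w (0, l) / D) = 1"
      unfolding sum_divide_distrib[symmetric] D_def[symmetric] using D by simp
    moreover have "0 \<le> w (i, j) / D" if "i \<le> k" "j \<in> {1..s i}" for i j
      using w(1) that D by (simp add: I_def)
    ultimately have "\<mu> \<in> RD_values k f s v"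
      unfolding RD_values_def
      by (intro CollectI exI[of _ "\<lambda>l. w (0, l) / D"] exI[of _ "\<lambda>i j. w (i, j) / D"]) auto
    then show ?thesis
      using \<mu> by blast
  qed
  note attained = this
  have "inf_RP k f V \<le> sup_RD k f s v"
  proof (cases "inf_RP k f V = -\<infinity>")
    case False
    then obtain \<mu> where "\<mu> \<in> RD_values k f s v" "inf_RP k f V = ereal \<mu>"
      using attained by blast
    then show ?thesis
      by (simp add: sup_RD_def SUP_upper)
  qed simp
  with weak attained show ?thesis
    by (simp add: antisym)
qed

end
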